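(* Let $H$ be a real Hilbert space and $T\colon H\to H$ a nonexpansive operator with $\operatorname{Fix}T\neq\emptyset$. Let $\eta\in(0,1)$, $\sigma>0$, $\alpha\ge2$, $\theta:=(1-\eta)+\eta(\alpha-1)$, let $x^{-1},x^0\in H$, and let $(x^k)$ be generated by $$x^{k+1}=x^k+\frac{\theta}{k+\sigma}\big(T(x^k)-x^k\big)+\Big(1-\frac{\alpha}{k+\sigma}\Big)\big(T(x^k)-T(x^{k-1})\big),\qquad k\ge0.$$ Then: (i) $\|x^k-T(x^k)\|=\mathcal O(k^{-1})$ as $k\to+\infty$. Suppose now that $\alpha>2$ and let $z^*\in\operatorname{Fix}T$. Then: (ii) $\displaystyle\sum_{k\in\mathbb N}\Big(\langle x^k-T(x^k),T(x^k)-z^*\rangle+\tfrac12\|x^k-T(x^k)\|^2\Big)<+\infty$, $\displaystyle\sum_{k\in\mathbb N}k\|x^k-T(x^k)\|^2<+\infty$, and $\displaystyle\sum_{k\in\mathbb N}k\|x^k-x^{k-1}\|^2<+\infty$. (iii) The sequence $(x^k)_{k\in\mathbb N}$ converges weakly to a fixed point of $T$ as $k\to+\infty$. (iv) As $k\to+\infty$, $$\langle x^k-T(x^k),T(x^k)-z^*\rangle+\tfrac12\|x^k-T(x^k)\|^2=o(k^{-1}),\qquad\|x^k-x^{k-1}\|=o(k^{-1}),\qquad\|x^k-T(x^k)\|=o(k^{-1}).$$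
   Context: $T$ is nonexpansive if $\|T(x)-T(y)\|\le\|x-y\|$ for all $x,y\in H$; $\operatorname{Fix}T:=\{x\in H: T(x)=x\}$. *)

theory Defs
  imports "HOL-Analysis.Analysis" "HOL-Library.Landau_Symbols"
begin

definition nonexpansive :: "('a::real_normed_vector \<Rightarrow> 'a) \<Rightarrow> bool" where
  "nonexpansive T \<longleftrightarrow> (\<forall>x y. norm (T x - T y) \<le> norm (x - y))"

definition Fix :: "('a \<Rightarrow> 'a) \<Rightarrow> 'a set" where
  "Fix T = {x. T x = x}"

text \<open>Weak convergence in an inner product space, where the functionals are represented
  by inner products. In a Hilbert space these are all the continuous linear functionals.\<close>

definition weakly_converges_to :: "(nat \<Rightarrow> 'a::real_inner) \<Rightarrow> 'a \<Rightarrow> bool" where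
  "weakly_converges_to x l \<longleftrightarrow> (\<forall>y. (\<lambda>k. inner (x k) y) \<longlonglongrightarrow> inner l y)"

text \<open>The iterates are indexed by \<^typ>\<open>int\<close> so that the starting points are literally
  \<open>x (-1)\<close> and \<open>x 0\<close>. Only indices \<open>\<ge> -1\<close> are constrained.\<close>

definition fast_KM_iteration ::
    "('a::real_inner \<Rightarrow> 'a) \<Rightarrow> real \<Rightarrow> real \<Rightarrow> real \<Rightarrow> (int \<Rightarrow> 'a) \<Rightarrow> bool" where
  "fast_KM_iteration T \<eta> \<sigma> \<alpha> x \<longleftrightarrow>
     (let \<theta> = (1 - \<eta>) + \<eta> * (\<alpha> - 1) in
      \<forall>k::nat. x (int k + 1) =
        x (int k) + (\<theta> / (real k + \<sigma>)) *\<^sub>R (T (x (int k)) - x (int k))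
          + (1 - \<alpha> / (real k + \<sigma>)) *\<^sub>R (T (x (int k)) - T (x (int k - 1))))"

end

theory Submission imports Defs begin

text \<open>
  Write \<open>y\<^sub>k = T x\<^sub>k\<close>, \<open>r\<^sub>k = x\<^sub>k - T x\<^sub>k\<close>, \<open>v\<^sub>k = y\<^sub>k - y\<^sub>k\<^sub>-\<^sub>1\<close> and \<open>t = k + \<sigma>\<close>. In these variables the
  iteration becomes \<open>t (v\<^sub>k\<^sub>+\<^sub>1 + r\<^sub>k\<^sub>+\<^sub>1) = (t - \<alpha>) v\<^sub>k + (t - \<theta>) r\<^sub>k\<close>, which is an implicit
  discretisation of \<open>y'' + (\<alpha>/t) y' + r' + (\<theta>/t) r = 0\<close>. Nonexpansiveness enters only through
  \<open>\<langle>r\<^sub>k\<^sub>+\<^sub>1 - r\<^sub>k, v\<^sub>k\<^sub>+\<^sub>1\<rangle> + |r\<^sub>k\<^sub>+\<^sub>1 - r\<^sub>k|\<^sup>2 / 2 \<ge> 0\<close> and its special case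
  \<open>\<langle>r\<^sub>k, y\<^sub>k - z\<rangle> + |r\<^sub>k|\<^sup>2 / 2 \<ge> 0\<close> for fixed points \<open>z\<close>; the left-hand side of the latter is
  called the gap.

  With \<open>Q = (t - \<alpha>) v + (t - \<theta>) r\<close>, the Lyapunov function is \<open>\<mu> P + (1 - c) F + c G\<close>, where
  \<open>P = (\<alpha> - 1)/2 |y - z|\<^sup>2 + \<langle>y - z, Q\<rangle>\<close> ties the iterates to \<open>z\<close>,
  \<open>F = (t - \<alpha>)\<^sup>2/2 |v|\<^sup>2 + \<theta> (t - \<theta>)/2 |r|\<^sup>2\<close> and \<open>G = |Q|\<^sup>2/2\<close>. The increments of \<open>P\<close> and \<open>G\<close>
  are exact identities. In the increment of \<open>F\<close> the terms in \<open>|r\<^sub>k\<^sub>+\<^sub>1 - r\<^sub>k|\<^sup>2\<close> are absorbed by the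
  first inequality above, which is what makes the discrete estimate as sharp as the continuous
  one. Choosing \<open>\<mu> = \<theta> + c (\<alpha> - 2)\<close> removes the part of the mixed term \<open>\<langle>v, r\<rangle>\<close> that grows with \<open>t\<close>
  (lemma \<open>energy_step\<close>), and completing squares bounds the energy from below by
  \<open>t\<^sup>2 |r|\<^sup>2\<close> up to a positive factor (lemma \<open>energy_square_form\<close>).

  For \<open>\<alpha> = 2\<close> one has \<open>\<theta> = \<mu> = 1\<close>, every term of the bound on the increment vanishes, the energy decreases,
  and \<open>t |r|\<close> is bounded. For \<open>\<alpha> > 2\<close> and \<open>0 < c < 1 - \<eta>\<close> the energy eventually decreases by at least a multiple
  of the gap plus a multiple of \<open>t (|v|\<^sup>2 + |r|\<^sup>2)\<close>, which gives the summability
  statements. This persists for all \<open>\<mu>\<close> in a small interval. As the energy is affine in \<open>\<mu>\<close>,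
  the convergence of two such energies yields the convergence of \<open>P\<close> and of the kinetic part
  \<open>W = (1 - c) F + c G\<close> separately. Since \<open>W \<le> t\<^sup>2 (|v|\<^sup>2 + |r|\<^sup>2)\<close>, the series of \<open>W / t\<close> converges,
  so the limit of \<open>W\<close> is \<open>0\<close>; this is the \<open>o(1/k)\<close> rate. Then \<open>Q\<close> tends to \<open>0\<close>, so the
  convergence of \<open>P\<close> becomes that of \<open>|y\<^sub>k - z|\<close>, hence of \<open>|x\<^sub>k - z|\<close>, for every fixed point \<open>z\<close>,
  and Opial's argument gives weak convergence. Opial's lemma is proved here by asymptotic centers,
  which replaces weak compactness by completeness.
\<close>

section \<open>The energy and its increment\<close>

text \<open>
  The parameters \<open>d\<close>, \<open>v\<close>, \<open>r\<close> stand for \<open>y\<^sub>k - z\<close>, \<open>y\<^sub>k - y\<^sub>k\<^sub>-\<^sub>1\<close> and \<open>x\<^sub>k - T x\<^sub>k\<close>, and \<open>t\<close> for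
  \<open>k + \<sigma>\<close>. The estimates below treat them as arbitrary vectors linked by one step of the recurrence.
  The energy is affine both in \<open>\<mu>\<close> and in \<open>c\<close>; the value \<open>\<mu> = 0\<close> leaves the kinetic part, which
  does not depend on \<open>d\<close>.
\<close>

definition energy :: "real \<Rightarrow> real \<Rightarrow> real \<Rightarrow> real \<Rightarrow> real \<Rightarrow> 'a \<Rightarrow> 'a \<Rightarrow> 'a::real_inner \<Rightarrow> real" where
  "energy \<alpha> \<theta> \<mu> c t d v r =
     \<mu> * ((\<alpha> - 1) / 2 * (norm d)\<^sup>2 + inner d ((t - \<alpha>) *\<^sub>R v + (t - \<theta>) *\<^sub>R r))
     + (1 - c) * ((t - \<alpha>)\<^sup>2 / 2 * (norm v)\<^sup>2 + \<theta> * (t - \<theta>) / 2 * (norm r)\<^sup>2)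
     + c / 2 * (norm ((t - \<alpha>) *\<^sub>R v + (t - \<theta>) *\<^sub>R r))\<^sup>2"

text \<open>
  For \<open>r = x - T x\<close> and \<open>d = T x - z\<close> with \<open>z\<close> fixed, this equals
  \<open>(|x - z|\<^sup>2 - |T x - z|\<^sup>2) / 2\<close>.
\<close>

definition gap :: "'a \<Rightarrow> 'a::real_inner \<Rightarrow> real" where
  "gap r d = inner r d + 1 / 2 * (norm r)\<^sup>2"

lemma correlation_step:
  fixes d v r v' r' :: "'a::real_inner"
  assumes "t *\<^sub>R (v' + r') = (t - \<alpha>) *\<^sub>R v + (t - \<theta>) *\<^sub>R r"
  shows "(\<alpha> - 1) / 2 * (norm (d + v'))\<^sup>2 + inner (d + v') ((t + 1 - \<alpha>) *\<^sub>R v' + (t + 1 - \<theta>) *\<^sub>R r')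
       = (\<alpha> - 1) / 2 * (norm d)\<^sup>2 + inner d ((t - \<alpha>) *\<^sub>R v + (t - \<theta>) *\<^sub>R r)
         - (\<theta> - 1) * inner (d + v') r' + (t - (\<alpha> - 1) / 2) * (norm v')\<^sup>2 + t * inner v' r'"
  unfolding assms [symmetric]
  by (simp add: power2_norm_eq_inner inner_simps inner_commute field_simps)

text \<open>
  The new momentum \<open>Q'\<close> differs from \<open>t (v' + r') = Q\<close> only by \<open>- (\<alpha> - 1) v' - (\<theta> - 1) r'\<close>, a quantity
  of the new step alone. The same observation drives the preceding identity.
\<close>

lemma momentum_step:
  fixes v r v' r' :: "'a::real_inner"
  assumes "t *\<^sub>R (v' + r') = (t - \<alpha>) *\<^sub>R v + (t - \<theta>) *\<^sub>R r"
  shows "(norm ((t + 1 - \<alpha>) *\<^sub>R v' + (t + 1 - \<theta>) *\<^sub>R r'))\<^sup>2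
       = (norm ((t - \<alpha>) *\<^sub>R v + (t - \<theta>) *\<^sub>R r))\<^sup>2
         - (\<alpha> - 1) * (2 * t - (\<alpha> - 1)) * (norm v')\<^sup>2 - (\<theta> - 1) * (2 * t - (\<theta> - 1)) * (norm r')\<^sup>2
         - 2 * (t * (\<alpha> - 1 + (\<theta> - 1)) - (\<alpha> - 1) * (\<theta> - 1)) * inner v' r'"
  unfolding assms [symmetric] power2_norm_eq_inner
  by (simp add: inner_simps inner_commute field_simps power2_eq_square)

text \<open>
  Solving the recurrence for \<open>(t - \<alpha>) v\<close> and squaring produces \<open>(t - \<theta>)\<^sup>2/2 |r' - r|\<^sup>2\<close>, the mixed term
  \<open>t (t - \<theta>) \<langle>r' - r, v'\<rangle>\<close>, and \<open>\<theta> (t - \<theta>) \<langle>r' - r, r'\<rangle>\<close>, which contributes another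
  \<open>\<theta> (t - \<theta>)/2 |r' - r|\<^sup>2\<close>. Cocoercivity costs \<open>t (t - \<theta>)/2 |r' - r|\<^sup>2\<close>, which is exactly
  the sum of the two squares, so no error is left. The weight \<open>\<theta> (t - \<theta>)/2\<close> of \<open>|r|\<^sup>2\<close> in the energy is
  dictated by this cancellation.
\<close>

lemma velocity_step:
  fixes v r v' r' :: "'a::real_inner"
  assumes step: "t *\<^sub>R (v' + r') = (t - \<alpha>) *\<^sub>R v + (t - \<theta>) *\<^sub>R r"
    and cocoercive: "0 \<le> inner (r' - r) v' + 1 / 2 * (norm (r' - r))\<^sup>2"
    and t: "\<theta> \<le> t" "0 \<le> t"
  shows "(t + 1 - \<alpha>)\<^sup>2 / 2 * (norm v')\<^sup>2 + \<theta> * (t + 1 - \<theta>) / 2 * (norm r')\<^sup>2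
       \<le> (t - \<alpha>)\<^sup>2 / 2 * (norm v)\<^sup>2 + \<theta> * (t - \<theta>) / 2 * (norm r)\<^sup>2
         - (\<alpha> - 1) * (t - (\<alpha> - 1) / 2) * (norm v')\<^sup>2 - \<theta> * (\<theta> - 1) / 2 * (norm r')\<^sup>2
         - \<theta> * t * inner v' r'"
proof -
  have V: "(t - \<alpha>) *\<^sub>R v = t *\<^sub>R (v' + r') - (t - \<theta>) *\<^sub>R r"
    using step by simp
  have "(t - \<alpha>)\<^sup>2 * (norm v)\<^sup>2 = (norm (t *\<^sub>R (v' + r') - (t - \<theta>) *\<^sub>R r))\<^sup>2"
    unfolding V [symmetric] by (simp add: power_mult_distrib)
  moreover have "0 \<le> t * (t - \<theta>) * (inner (r' - r) v' + 1 / 2 * (norm (r' - r))\<^sup>2)"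
    using t cocoercive by simp
  ultimately show ?thesis
    unfolding power2_norm_eq_inner
    by (simp add: inner_simps inner_commute field_simps power2_eq_square)
qed

text \<open>
  The coefficient of \<open>t\<close> in the mixed term vanishes for \<open>\<mu> = \<theta> + c (\<alpha> - 2)\<close>. The remaining
  terms damp \<open>|v'|\<^sup>2\<close> if \<open>\<mu> < \<alpha> - 1\<close>, and \<open>|r'|\<^sup>2\<close> if \<open>c > 0\<close> and \<open>\<theta> > 1\<close>, once \<open>t\<close> is large.
\<close>

lemma energy_step:
  fixes d v r v' r' :: "'a::real_inner"
  assumes step: "t *\<^sub>R (v' + r') = (t - \<alpha>) *\<^sub>R v + (t - \<theta>) *\<^sub>R r"
    and cocoercive: "0 \<le> inner (r' - r) v' + 1 / 2 * (norm (r' - r))\<^sup>2"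
    and t: "\<theta> \<le> t" "0 \<le> t" and c: "c \<le> 1"
  shows "energy \<alpha> \<theta> \<mu> c (t + 1) (d + v') v' r' + \<mu> * (\<theta> - 1) * gap r' (d + v')
       \<le> energy \<alpha> \<theta> \<mu> c t d v r
         - (\<alpha> - 1 - \<mu>) * (t - (\<alpha> - 1) / 2) * (norm v')\<^sup>2
         - (\<theta> - 1) * (c * (t - (\<theta> - 1) / 2) + (1 - c) * \<theta> / 2 - \<mu> / 2) * (norm r')\<^sup>2
         + (t * (\<mu> - \<theta> - c * (\<alpha> - 2)) + c * (\<alpha> - 1) * (\<theta> - 1)) * inner v' r'"
proof -
  define P P' F F' G G' where
    "P = (\<alpha> - 1) / 2 * (norm d)\<^sup>2 + inner d ((t - \<alpha>) *\<^sub>R v + (t - \<theta>) *\<^sub>R r)"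
    and "P' = (\<alpha> - 1) / 2 * (norm (d + v'))\<^sup>2 + inner (d + v') ((t + 1 - \<alpha>) *\<^sub>R v' + (t + 1 - \<theta>) *\<^sub>R r')"
    and "F = (t - \<alpha>)\<^sup>2 / 2 * (norm v)\<^sup>2 + \<theta> * (t - \<theta>) / 2 * (norm r)\<^sup>2"
    and "F' = (t + 1 - \<alpha>)\<^sup>2 / 2 * (norm v')\<^sup>2 + \<theta> * (t + 1 - \<theta>) / 2 * (norm r')\<^sup>2"
    and "G = (norm ((t - \<alpha>) *\<^sub>R v + (t - \<theta>) *\<^sub>R r))\<^sup>2"
    and "G' = (norm ((t + 1 - \<alpha>) *\<^sub>R v' + (t + 1 - \<theta>) *\<^sub>R r'))\<^sup>2"
  define vv rr vr g where "vv = (norm v')\<^sup>2" and "rr = (norm r')\<^sup>2" and "vr = inner v' r'"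
    and "g = inner (d + v') r'"
  have E: "energy \<alpha> \<theta> \<mu> c t d v r = \<mu> * P + (1 - c) * F + c / 2 * G"
    "energy \<alpha> \<theta> \<mu> c (t + 1) (d + v') v' r' = \<mu> * P' + (1 - c) * F' + c / 2 * G'"
    unfolding energy_def P_def F_def G_def P'_def F'_def G'_def by simp_all
  have gap: "gap r' (d + v') = g + 1 / 2 * rr"
    unfolding gap_def g_def rr_def by (simp add: inner_commute)
  have P: "P' = P - (\<theta> - 1) * g + (t - (\<alpha> - 1) / 2) * vv + t * vr"
    using correlation_step [OF step, of d] unfolding P_def P'_def vv_def vr_def g_def by simp
  have G: "G' = G - (\<alpha> - 1) * (2 * t - (\<alpha> - 1)) * vv - (\<theta> - 1) * (2 * t - (\<theta> - 1)) * rr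
         - 2 * (t * (\<alpha> - 1 + (\<theta> - 1)) - (\<alpha> - 1) * (\<theta> - 1)) * vr"
    using momentum_step [OF step] unfolding G_def G'_def vv_def vr_def rr_def by simp
  have "F' \<le> F - (\<alpha> - 1) * (t - (\<alpha> - 1) / 2) * vv - \<theta> * (\<theta> - 1) / 2 * rr - \<theta> * t * vr"
    using velocity_step [OF step cocoercive t] unfolding F_def F'_def vv_def vr_def rr_def .
  then have "(1 - c) * F' \<le> (1 - c) * (F - (\<alpha> - 1) * (t - (\<alpha> - 1) / 2) * vv
      - \<theta> * (\<theta> - 1) / 2 * rr - \<theta> * t * vr)"
    using c by (intro mult_left_mono) auto
  then show ?thesis
    unfolding E gap P G vv_def [symmetric] vr_def [symmetric] rr_def [symmetric]
    by (simp add: field_simps power2_eq_square)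
qed

text \<open>
  All four summands are nonnegative when \<open>0 \<le> \<mu> \<le> \<alpha> - 1\<close>, \<open>0 < c < 1\<close>, \<open>t\<close> is large and the gap is
  nonnegative, and the last one grows like \<open>t\<^sup>2 |r|\<^sup>2\<close>.
\<close>

lemma energy_square_form:
  fixes d v r :: "'a::real_inner"
  shows "energy \<alpha> \<theta> \<mu> c t d v r =
      1 / 2 * (norm (\<mu> *\<^sub>R d + (t - \<alpha>) *\<^sub>R v + (c * (t - \<theta>)) *\<^sub>R r))\<^sup>2
    + \<mu> * (\<alpha> - 1 - \<mu>) / 2 * (norm d)\<^sup>2
    + \<mu> * (1 - c) * (t - \<theta>) * gap r d
    + (1 - c) * (t - \<theta>) / 2 * (\<theta> - \<mu> + c * (t - \<theta>)) * (norm r)\<^sup>2"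
  unfolding energy_def gap_def power2_norm_eq_inner
  by (simp add: inner_simps inner_commute field_simps power2_eq_square)

text \<open>
  The factor of \<open>\<mu>\<close> is the only place where \<open>d\<close> enters, so two energies with different \<open>\<mu>\<close> determine
  both this factor and the kinetic part.
\<close>

lemma energy_affine:
  "energy \<alpha> \<theta> \<mu> c t d v r =
     energy \<alpha> \<theta> 0 c t d v r
     + \<mu> * ((\<alpha> - 1) / 2 * (norm d)\<^sup>2 + inner d ((t - \<alpha>) *\<^sub>R v + (t - \<theta>) *\<^sub>R r))"
  unfolding energy_def by simp

lemma kinetic_le:
  fixes d v r :: "'a::real_inner"
  assumes "0 \<le> c" "c \<le> 1" "0 \<le> \<alpha>" "0 \<le> \<theta>" "\<alpha> \<le> t" "\<theta> \<le> t"
  shows "energy \<alpha> \<theta> 0 c t d v r \<le> t\<^sup>2 * ((norm v)\<^sup>2 + (norm r)\<^sup>2)"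
proof -
  define V R where "V = (t - \<alpha>) *\<^sub>R v" and "R = (t - \<theta>) *\<^sub>R r"
  define S where "S = t\<^sup>2 * ((norm v)\<^sup>2 + (norm r)\<^sup>2)"
  have a: "(t - \<alpha>)\<^sup>2 \<le> t\<^sup>2" "(t - \<theta>)\<^sup>2 \<le> t\<^sup>2" using assms by (auto intro!: power_mono)
  have "\<theta> * (t - \<theta>) \<le> t * t" using assms by (intro mult_mono) auto
  then have b: "\<theta> * (t - \<theta>) * (norm r)\<^sup>2 \<le> t\<^sup>2 * (norm r)\<^sup>2"
    by (intro mult_right_mono) (auto simp: power2_eq_square)
  have v: "(t - \<alpha>)\<^sup>2 * (norm v)\<^sup>2 \<le> t\<^sup>2 * (norm v)\<^sup>2"
    and r: "(t - \<theta>)\<^sup>2 * (norm r)\<^sup>2 \<le> t\<^sup>2 * (norm r)\<^sup>2"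
    using a by (auto intro!: mult_right_mono)
  have "(norm (V + R))\<^sup>2 + (norm (V - R))\<^sup>2 = 2 * (norm V)\<^sup>2 + 2 * (norm R)\<^sup>2"
    unfolding power2_norm_eq_inner by (simp add: inner_simps inner_commute)
  then have "(norm (V + R))\<^sup>2 \<le> 2 * (norm V)\<^sup>2 + 2 * (norm R)\<^sup>2"
    using zero_le_power2 [of "norm (V - R)"] by linarith
  also have "\<dots> = 2 * ((t - \<alpha>)\<^sup>2 * (norm v)\<^sup>2) + 2 * ((t - \<theta>)\<^sup>2 * (norm r)\<^sup>2)"
    unfolding V_def R_def by (simp add: power_mult_distrib)
  also have "\<dots> \<le> 2 * S" using v r unfolding S_def by (simp add: distrib_left)
  finally have "c * (norm (V + R))\<^sup>2 \<le> c * (2 * S)" using assms by (intro mult_left_mono)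
  moreover have "(t - \<alpha>)\<^sup>2 / 2 * (norm v)\<^sup>2 + \<theta> * (t - \<theta>) / 2 * (norm r)\<^sup>2 \<le> S"
  proof -
    have "(t - \<alpha>)\<^sup>2 * (norm v)\<^sup>2 + \<theta> * (t - \<theta>) * (norm r)\<^sup>2 \<le> S"
      using v b unfolding S_def by (simp add: distrib_left)
    moreover have "0 \<le> S" unfolding S_def by simp
    ultimately show ?thesis by simp
  qed
  then have "(1 - c) * ((t - \<alpha>)\<^sup>2 / 2 * (norm v)\<^sup>2 + \<theta> * (t - \<theta>) / 2 * (norm r)\<^sup>2) \<le> (1 - c) * S"
    using assms by (intro mult_left_mono) auto
  ultimately show ?thesis
    unfolding energy_def V_def [symmetric] R_def [symmetric] S_def [symmetric]
    by (simp add: algebra_simps)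
qed

section \<open>Descent sequences and asymptotics\<close>

lemma descent_convergent_summable:
  fixes E a :: "nat \<Rightarrow> real"
  assumes desc: "\<forall>\<^sub>F k in sequentially. E (Suc k) + a (Suc k) \<le> E k"
    and E: "\<forall>\<^sub>F k in sequentially. 0 \<le> E k" and a: "\<forall>\<^sub>F k in sequentially. 0 \<le> a k"
  shows "convergent E" and "summable a"
proof -
  obtain K where K: "\<And>k. k \<ge> K \<Longrightarrow> E (Suc k) + a (Suc k) \<le> E k \<and> 0 \<le> E k \<and> 0 \<le> a k"
    using eventually_conj [OF desc eventually_conj [OF E a]]
    by (auto simp: eventually_sequentially)
  have "decseq (\<lambda>k. E (k + K))"
  proof (rule decseq_SucI)
    fix k
    show "E (Suc k + K) \<le> E (k + K)"
      using K [of "k + K"] K [of "Suc (k + K)"] by simp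
  qed
  moreover have "\<bar>E (k + K)\<bar> \<le> E K" for k
    using calculation K [of "k + K"] decseqD [of "\<lambda>k. E (k + K)" 0 k] by auto
  ultimately have "convergent (\<lambda>k. E (k + K))"
    by (metis Bseq_monoseq_convergent BseqI' decseq_imp_monoseq real_norm_def)
  then show "convergent E"
    using convergent_ignore_initial_segment by blast
  \<comment> \<open>The remaining energy is kept on the left so that the induction telescopes.\<close>
  have telescope: "(\<Sum>i<n. a (i + Suc K)) + E (n + K) \<le> E K" for n
  proof (induction n)
    case (Suc n)
    then show ?case using K [of "n + K"] by simp
  qed simp
  have "(\<Sum>i<n. a (i + Suc K)) \<le> E K" for n
    using telescope [of n] K [of "n + K"] by simp
  then have "summable (\<lambda>i. a (i + Suc K))"
    using K by (intro summableI_nonneg_bounded) auto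
  then show "summable a"
    using summable_iff_shift by blast
qed

text \<open>
  If the limit were positive, \<open>b k\<close> would eventually dominate a multiple of \<open>1 / (k + s)\<close>, and the
  harmonic series would converge.
\<close>

lemma limit_zero_if_summable_div:
  fixes W :: "nat \<Rightarrow> real"
  assumes W: "W \<longlonglongrightarrow> L" and nonneg: "\<forall>\<^sub>F k in sequentially. 0 \<le> W k"
    and b: "summable b" and le: "\<forall>\<^sub>F k in sequentially. W k \<le> (real k + s) * b k"
    and s: "0 < s"
  shows "L = 0"
proof (rule ccontr)
  assume "L \<noteq> 0"
  moreover have "0 \<le> L"
    using W nonneg tendsto_lowerbound by (metis sequentially_bot)
  ultimately have L: "0 < L" by simp
  then have "\<forall>\<^sub>F k in sequentially. L / 2 < W k"
    using W by (intro order_tendstoD(1)) auto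
  with le have "\<forall>\<^sub>F k in sequentially. norm (1 / (real k + s)) \<le> 2 / L * b k"
  proof eventually_elim
    case (elim k)
    then have "L / 2 \<le> (real k + s) * b k" by linarith
    moreover have "0 < real k + s" using s by linarith
    ultimately show ?case using L by (simp add: field_simps)
  qed
  then have summ: "summable (\<lambda>k. 1 / (real k + s))"
    by (rule summable_comparison_test_ev) (intro summable_mult b)
  obtain n :: nat where n: "s \<le> real n" using real_arch_simple by blast
  have "summable (\<lambda>k. 1 / real (k + Suc n))"
  proof (rule summable_comparison_test_ev [OF _ summ])
    show "\<forall>\<^sub>F k in sequentially. norm (1 / real (k + Suc n)) \<le> 1 / (real k + s)"
      using n s by (intro always_eventually allI) (auto simp: field_simps)
  qed
  then have "summable (\<lambda>k. 1 / real k)"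
    using summable_iff_shift [of "\<lambda>k. 1 / real k" "Suc n"] by simp
  then show False
    using not_summable_harmonic [where 'a = real] by (simp add: inverse_eq_divide)
qed

lemma smallo_inverseI:
  fixes f :: "nat \<Rightarrow> real"
  assumes "(\<lambda>k. real k * f k) \<longlonglongrightarrow> 0"
  shows "f \<in> o(\<lambda>k. 1 / real k)"
proof (rule smalloI_tendsto)
  show "(\<lambda>k. f k / (1 / real k)) \<longlonglongrightarrow> 0" using assms by (simp add: mult.commute)
  show "\<forall>\<^sub>F k in sequentially. 1 / real k \<noteq> 0"
    using eventually_gt_at_top [of 0] by eventually_elim simp
qed

lemma eventually_linear_ge:
  fixes p q s :: real
  assumes "0 < p"
  shows "\<forall>\<^sub>F k in sequentially. q \<le> p * (real k + s)"
proof -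
  have "\<forall>\<^sub>F k in sequentially. q / p - s \<le> real k"
    using filterlim_real_sequentially unfolding filterlim_at_top by blast
  then show ?thesis
  proof eventually_elim
    case (elim k)
    then have "q / p \<le> real k + s" by simp
    then show ?case using assms by (simp add: field_simps)
  qed
qed

section \<open>Asymptotic centers and Opial's lemma\<close>

lemma midpoint_norm_sq:
  fixes a p q :: "'a::real_inner"
  shows "(norm (a - (1 / 2) *\<^sub>R (p + q)))\<^sup>2
       = (norm (a - p))\<^sup>2 / 2 + (norm (a - q))\<^sup>2 / 2 - (norm (p - q))\<^sup>2 / 4"
  by (simp add: power2_norm_eq_inner inner_simps inner_commute field_simps)

text \<open>
  The point \<open>p\<close> minimises \<open>w \<mapsto> limsup |x\<^sub>k - w|\<^sup>2\<close> along the filter and \<open>m\<close> is the minimum. Filters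
  instead of subsequences spare the extraction of subsequences: a subsequence along which some event
  happens is the infimum of the sequential filter with the principal filter of that event.
\<close>

definition asymptotic_center :: "'b filter \<Rightarrow> ('b \<Rightarrow> 'a::real_inner) \<Rightarrow> real \<Rightarrow> 'a \<Rightarrow> bool" where
  "asymptotic_center F x m p \<longleftrightarrow>
     (\<forall>e>0. \<forall>\<^sub>F k in F. (norm (x k - p))\<^sup>2 \<le> m + e) \<and>
     (\<forall>w b. (\<forall>\<^sub>F k in F. (norm (x k - w))\<^sup>2 \<le> b) \<longrightarrow> m \<le> b)"

text \<open>
  The midpoint of two almost minimisers would undercut the minimum if they were far apart.
\<close>

lemma almost_centers_close:
  fixes x :: "'b \<Rightarrow> 'a::real_inner"
  assumes min: "\<And>w b. \<forall>\<^sub>F k in F. (norm (x k - w))\<^sup>2 \<le> b \<Longrightarrow> m \<le> b"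
    and p: "\<forall>\<^sub>F k in F. (norm (x k - p))\<^sup>2 \<le> m + e"
    and q: "\<forall>\<^sub>F k in F. (norm (x k - q))\<^sup>2 \<le> m + e"
  shows "(norm (p - q))\<^sup>2 \<le> 4 * e"
proof -
  have "\<forall>\<^sub>F k in F. (norm (x k - (1 / 2) *\<^sub>R (p + q)))\<^sup>2 \<le> m + e - (norm (p - q))\<^sup>2 / 4"
    using p q unfolding midpoint_norm_sq by eventually_elim auto
  from min [OF this] show ?thesis by simp
qed

text \<open>
  Minimising sequences are Cauchy by the previous lemma, so completeness provides the minimiser.
\<close>

lemma asymptotic_center_exists:
  fixes x :: "'b \<Rightarrow> 'a::{real_inner,complete_space}"
  assumes F: "F \<noteq> bot" and bdd: "\<forall>\<^sub>F k in F. norm (x k) \<le> B"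
  shows "\<exists>m p. asymptotic_center F x m p"
proof -
  define S where "S = {b. \<exists>w. \<forall>\<^sub>F k in F. (norm (x k - w))\<^sup>2 \<le> b}"
  define m where "m = Inf S"
  have "\<forall>\<^sub>F k in F. (norm (x k - 0))\<^sup>2 \<le> B\<^sup>2"
    using bdd by eventually_elim (simp add: power_mono)
  then have ne: "S \<noteq> {}" unfolding S_def by blast
  have "0 \<le> b" if "b \<in> S" for b
  proof -
    from that obtain w where "\<forall>\<^sub>F k in F. (norm (x k - w))\<^sup>2 \<le> b" unfolding S_def by blast
    then obtain k where "(norm (x k - w))\<^sup>2 \<le> b"
      using F eventually_happens by blast
    then show ?thesis by (meson order_trans zero_le_power2)
  qed
  then have below: "bdd_below S" by (intro bdd_belowI)
  have min: "m \<le> b" if "\<forall>\<^sub>F k in F. (norm (x k - w))\<^sup>2 \<le> b" for w b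
    unfolding m_def using that below by (intro cInf_lower) (auto simp: S_def)
  have "\<exists>w. \<forall>\<^sub>F k in F. (norm (x k - w))\<^sup>2 \<le> m + 1 / real (Suc n)" for n
  proof -
    have "Inf S < m + 1 / real (Suc n)" unfolding m_def by simp
    then obtain b w where "b < m + 1 / real (Suc n)" "\<forall>\<^sub>F k in F. (norm (x k - w))\<^sup>2 \<le> b"
      using cInf_lessD [OF ne] unfolding S_def by blast
    then show ?thesis by (intro exI [of _ w]) (auto elim!: eventually_mono)
  qed
  then obtain w where w: "\<And>n. \<forall>\<^sub>F k in F. (norm (x k - w n))\<^sup>2 \<le> m + 1 / real (Suc n)"
    by metis
  have close: "(norm (w i - w j))\<^sup>2 \<le> 4 * (1 / real (Suc n))" if "n \<le> i" "n \<le> j" for i j n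
  proof (rule almost_centers_close [OF min])
    have *: "\<forall>\<^sub>F k in F. (norm (x k - w i))\<^sup>2 \<le> m + 1 / real (Suc n)" if "n \<le> i" for i
    proof -
      have "1 / real (Suc i) \<le> 1 / real (Suc n)" using that by (simp add: frac_le)
      with w [of i] show ?thesis by (auto elim!: eventually_mono)
    qed
    show "\<forall>\<^sub>F k in F. (norm (x k - w i))\<^sup>2 \<le> m + 1 / real (Suc n)"
      "\<forall>\<^sub>F k in F. (norm (x k - w j))\<^sup>2 \<le> m + 1 / real (Suc n)"
      using * that by blast+
  qed
  have "Cauchy w"
  proof (rule metric_CauchyI)
    fix e :: real assume e: "0 < e"
    obtain n where n: "1 / real (Suc n) < e\<^sup>2 / 4"
      using e nat_approx_posE [of "e\<^sup>2 / 4"] by auto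
    have "dist (w i) (w j) < e" if "n \<le> i" "n \<le> j" for i j
    proof -
      have "(norm (w i - w j))\<^sup>2 < e\<^sup>2" using close [OF that] n by simp
      then show ?thesis using e by (simp add: dist_norm power_less_imp_less_base)
    qed
    then show "\<exists>M. \<forall>i\<ge>M. \<forall>j\<ge>M. dist (w i) (w j) < e" by blast
  qed
  then obtain p where p: "w \<longlonglongrightarrow> p" using Cauchy_convergent convergent_def by blast
  have "\<forall>\<^sub>F k in F. (norm (x k - p))\<^sup>2 \<le> m + e" if "0 < e" for e
  proof -
    have m0: "0 \<le> m" unfolding m_def using ne \<open>\<And>b. b \<in> S \<Longrightarrow> 0 \<le> b\<close> by (rule cInf_greatest)
    have "(\<lambda>n. (sqrt (m + 1 / real (Suc n)) + norm (w n - p))\<^sup>2) \<longlonglongrightarrow> (sqrt (m + 0) + norm (p - p))\<^sup>2"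
      by (intro tendsto_intros p LIMSEQ_Suc [OF lim_1_over_n])
    then have "(\<lambda>n. (sqrt (m + 1 / real (Suc n)) + norm (w n - p))\<^sup>2) \<longlonglongrightarrow> m"
      using m0 by simp
    then have "\<forall>\<^sub>F n in sequentially. (sqrt (m + 1 / real (Suc n)) + norm (w n - p))\<^sup>2 < m + e"
      using that by (intro order_tendstoD) auto
    then obtain n where n: "(sqrt (m + 1 / real (Suc n)) + norm (w n - p))\<^sup>2 < m + e"
      by (auto dest: eventually_happens)
    from w [of n] show ?thesis
    proof eventually_elim
      case (elim k)
      have "norm (x k - w n) \<le> sqrt (m + 1 / real (Suc n))"
        using elim by (rule real_le_rsqrt)
      then have "norm (x k - p) \<le> sqrt (m + 1 / real (Suc n)) + norm (w n - p)"
        using norm_triangle_ineq [of "x k - w n" "w n - p"] by simp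
      then have "(norm (x k - p))\<^sup>2 \<le> (sqrt (m + 1 / real (Suc n)) + norm (w n - p))\<^sup>2"
        by (intro power_mono) auto
      then show ?case using n by simp
    qed
  qed
  then show ?thesis unfolding asymptotic_center_def using min by blast
qed

text \<open>
  As \<open>|x\<^sub>k - T p| \<le> |x\<^sub>k - T x\<^sub>k| + |x\<^sub>k - p|\<close>, the point \<open>T p\<close> is as good as the center \<open>p\<close>, and
  the minimiser is unique.
\<close>

lemma asymptotic_center_fixed:
  fixes x :: "'b \<Rightarrow> 'a::real_inner"
  assumes T: "nonexpansive T" and res: "((\<lambda>k. x k - T (x k)) \<longlongrightarrow> 0) F"
    and center: "asymptotic_center F x m p" and F: "F \<noteq> bot"
  shows "p \<in> Fix T"
proof -
  have le: "\<forall>\<^sub>F k in F. (norm (x k - p))\<^sup>2 \<le> m + e" if "0 < e" for e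
    using center that unfolding asymptotic_center_def by blast
  have min: "m \<le> b" if "\<forall>\<^sub>F k in F. (norm (x k - w))\<^sup>2 \<le> b" for w b
    using center that unfolding asymptotic_center_def by blast
  have m0: "0 \<le> m"
  proof (rule field_le_epsilon)
    fix e :: real assume "0 < e"
    then obtain k where "(norm (x k - p))\<^sup>2 \<le> m + e"
      using F eventually_happens le by blast
    then show "0 \<le> m + e" by (meson order_trans zero_le_power2)
  qed
  have "(norm (T p - p))\<^sup>2 \<le> 4 * e" if e: "0 < e" for e
  proof (rule almost_centers_close [OF min])
    show "\<forall>\<^sub>F k in F. (norm (x k - p))\<^sup>2 \<le> m + e" using le e .
    have "((\<lambda>k. (norm (x k - T (x k)) + sqrt (m + e / 2))\<^sup>2) \<longlongrightarrow> (norm (0::'a) + sqrt (m + e / 2))\<^sup>2) F"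
      by (intro tendsto_intros res)
    moreover have "(norm (0::'a) + sqrt (m + e / 2))\<^sup>2 < m + e" using m0 e by simp
    ultimately have "\<forall>\<^sub>F k in F. (norm (x k - T (x k)) + sqrt (m + e / 2))\<^sup>2 < m + e"
      by (rule order_tendstoD)
    moreover have "\<forall>\<^sub>F k in F. (norm (x k - p))\<^sup>2 \<le> m + e / 2" using le e by simp
    ultimately show "\<forall>\<^sub>F k in F. (norm (x k - T p))\<^sup>2 \<le> m + e"
    proof eventually_elim
      case (elim k)
      have "norm (T (x k) - T p) \<le> norm (x k - p)" using T unfolding nonexpansive_def by blast
      also have "\<dots> \<le> sqrt (m + e / 2)" using elim(2) by (rule real_le_rsqrt)
      finally have "norm (x k - T p) \<le> norm (x k - T (x k)) + sqrt (m + e / 2)"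
        using norm_triangle_ineq [of "x k - T (x k)" "T (x k) - T p"] by simp
      then have "(norm (x k - T p))\<^sup>2 \<le> (norm (x k - T (x k)) + sqrt (m + e / 2))\<^sup>2"
        by (intro power_mono) auto
      then show ?case using elim(1) by simp
    qed
  qed
  from this [of "e / 4" for e] have "(norm (T p - p))\<^sup>2 \<le> 0 + e" if "0 < e" for e
    using that by simp
  then have "(norm (T p - p))\<^sup>2 \<le> 0" by (rule field_le_epsilon)
  then show ?thesis unfolding Fix_def by simp
qed

text \<open>
  On a filter finer than the sequential one, the center \<open>p'\<close> is a fixed point, so its minimum \<open>m'\<close> is
  the limit of the full sequence \<open>|x\<^sub>k - p'|\<^sup>2\<close>. Hence no finer filter has a minimum below the
  minimum \<open>m\<close> of the full sequence, whose center is \<open>p\<close>. If \<open>\<langle>x\<^sub>k - p, u\<rangle>\<close> stayed above some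
  \<open>d > 0\<close> infinitely often, then on the corresponding filter the point \<open>p + s u\<close> with small \<open>s > 0\<close>
  would improve on \<open>m\<close>, which is impossible.
\<close>

lemma opial_weak_convergence:
  fixes x :: "nat \<Rightarrow> 'a::{real_inner,complete_space}"
  assumes T: "nonexpansive T" and res: "(\<lambda>k. x k - T (x k)) \<longlonglongrightarrow> 0"
    and ne: "Fix T \<noteq> {}" and fejer: "\<And>z. z \<in> Fix T \<Longrightarrow> convergent (\<lambda>k. (norm (x k - z))\<^sup>2)"
  shows "\<exists>p\<in>Fix T. weakly_converges_to x p"
proof -
  obtain z where z: "z \<in> Fix T" using ne by blast
  obtain B where B: "\<And>k. norm ((norm (x k - z))\<^sup>2) \<le> B"
    using convergent_imp_Bseq [OF fejer [OF z]] unfolding Bseq_def by blast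
  have bdd: "norm (x k) \<le> sqrt B + norm z" for k
  proof -
    have "norm (x k - z) \<le> sqrt B" using B [of k] by (intro real_le_rsqrt) simp
    then show ?thesis using norm_triangle_ineq [of "x k - z" z] by simp
  qed
  have center: "\<exists>m p. p \<in> Fix T \<and> asymptotic_center F x m p \<and> ((\<lambda>k. (norm (x k - p))\<^sup>2) \<longlongrightarrow> m) sequentially"
    if F: "F \<noteq> bot" "F \<le> sequentially" for F
  proof -
    obtain m p where c: "asymptotic_center F x m p"
      using asymptotic_center_exists [OF F(1), of x "sqrt B + norm z"] bdd by auto
    have p: "p \<in> Fix T"
      using asymptotic_center_fixed [OF T tendsto_mono [OF F(2) res] c F(1)] .
    obtain l where l: "(\<lambda>k. (norm (x k - p))\<^sup>2) \<longlonglongrightarrow> l"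
      using fejer [OF p] unfolding convergent_def by blast
    have lF: "((\<lambda>k. (norm (x k - p))\<^sup>2) \<longlongrightarrow> l) F" using tendsto_mono [OF F(2) l] .
    have "l \<le> m"
    proof (rule field_le_epsilon)
      fix e :: real assume "0 < e"
      then have "\<forall>\<^sub>F k in F. (norm (x k - p))\<^sup>2 \<le> m + e"
        using c unfolding asymptotic_center_def by blast
      then show "l \<le> m + e" using tendsto_upperbound [OF lF _ F(1)] by blast
    qed
    moreover have "m \<le> l"
    proof (rule field_le_epsilon)
      fix e :: real assume "0 < e"
      then have "\<forall>\<^sub>F k in F. (norm (x k - p))\<^sup>2 < l + e" using lF by (intro order_tendstoD) auto
      then have "\<forall>\<^sub>F k in F. (norm (x k - p))\<^sup>2 \<le> l + e" by (auto elim: eventually_mono)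
      then show "m \<le> l + e" using c unfolding asymptotic_center_def by blast
    qed
    ultimately show ?thesis using p c l by auto
  qed
  obtain m p where p: "p \<in> Fix T" and c: "asymptotic_center sequentially x m p"
    and lim: "(\<lambda>k. (norm (x k - p))\<^sup>2) \<longlonglongrightarrow> m"
    using center [of sequentially] by auto
  have below: "\<forall>\<^sub>F k in sequentially. inner (x k - p) u < d" if d: "0 < d" for u d
  proof (rule ccontr)
    assume neg: "\<not> (\<forall>\<^sub>F k in sequentially. inner (x k - p) u < d)"
    define F where "F = inf sequentially (principal {k. d \<le> inner (x k - p) u})"
    have ev: "(\<forall>\<^sub>F k in F. Q k) \<longleftrightarrow> (\<forall>\<^sub>F k in sequentially. d \<le> inner (x k - p) u \<longrightarrow> Q k)" for Q
      unfolding F_def eventually_inf_principal by simp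
    have "F \<noteq> bot"
      using neg unfolding trivial_limit_def ev by (auto simp: not_le)
    moreover have "F \<le> sequentially" unfolding F_def by simp
    ultimately obtain m' p' where c': "asymptotic_center F x m' p'"
      and lim': "(\<lambda>k. (norm (x k - p'))\<^sup>2) \<longlonglongrightarrow> m'"
      using center by blast
    have "m \<le> m'"
    proof (rule field_le_epsilon)
      fix e :: real assume "0 < e"
      then have "\<forall>\<^sub>F k in sequentially. (norm (x k - p'))\<^sup>2 < m' + e"
        using lim' by (intro order_tendstoD) auto
      then have "\<forall>\<^sub>F k in sequentially. (norm (x k - p'))\<^sup>2 \<le> m' + e"
        by (auto elim: eventually_mono)
      then show "m \<le> m' + e" using c unfolding asymptotic_center_def by blast
    qed
    \<comment> \<open>The gain \<open>2 s d\<close> must beat \<open>s\<^sup>2 |u|\<^sup>2\<close>; adding \<open>1\<close> avoids a division by zero.\<close>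
    define s where "s = d / ((norm u)\<^sup>2 + 1)"
    have "0 < (norm u)\<^sup>2 + 1" by (simp add: add_nonneg_pos)
    then have s: "0 < s" and su: "s * (norm u)\<^sup>2 \<le> d"
      unfolding s_def using d by (auto simp: field_simps)
    have "\<forall>\<^sub>F k in sequentially. (norm (x k - p))\<^sup>2 < m + s * d / 2"
      using lim s d by (intro order_tendstoD) auto
    then have "\<forall>\<^sub>F k in F. (norm (x k - (p + s *\<^sub>R u)))\<^sup>2 \<le> m - s * d / 2"
      unfolding ev
    proof eventually_elim
      case (elim k)
      show ?case
      proof
        assume "d \<le> inner (x k - p) u"
        then have "s * d \<le> s * inner (x k - p) u" using s by simp
        moreover have "s * (s * (norm u)\<^sup>2) \<le> s * d" using su s by simp
        moreover have "(norm (x k - (p + s *\<^sub>R u)))\<^sup>2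
            = (norm (x k - p))\<^sup>2 - 2 * (s * inner (x k - p) u) + s * (s * (norm u)\<^sup>2)"
          by (simp add: power2_norm_eq_inner inner_simps inner_commute field_simps)
        ultimately show "(norm (x k - (p + s *\<^sub>R u)))\<^sup>2 \<le> m - s * d / 2" using elim by linarith
      qed
    qed
    then have "m' \<le> m - s * d / 2" using c' unfolding asymptotic_center_def by blast
    moreover have "0 < s * d" using s d by simp
    ultimately show False using \<open>m \<le> m'\<close> by linarith
  qed
  have "(\<lambda>k. inner (x k) u) \<longlonglongrightarrow> inner p u" for u
  proof (rule tendstoI)
    fix e :: real assume e: "0 < e"
    show "\<forall>\<^sub>F k in sequentially. dist (inner (x k) u) (inner p u) < e"
      using below [OF e, of u] below [OF e, of "- u"]
      by eventually_elim (auto simp: dist_real_def inner_diff_left)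
  qed
  then show ?thesis using p unfolding weakly_converges_to_def by blast
qed

section \<open>The iteration as a recurrence in residuals and velocities\<close>

text \<open>
  Nonexpansiveness of \<open>T\<close> in terms of residuals: with \<open>p = T a - T b\<close> and \<open>q\<close> the difference of the
  residuals, \<open>|p| \<le> |p + q|\<close> says \<open>\<langle>q, p\<rangle> + |q|\<^sup>2 / 2 \<ge> 0\<close>. The choice of a fixed point \<open>b\<close> gives the
  nonnegativity of the gap.
\<close>

lemma residual_cocoercive:
  fixes a b :: "'a::real_inner"
  assumes "nonexpansive T"
  shows "0 \<le> inner ((a - T a) - (b - T b)) (T a - T b) + 1 / 2 * (norm ((a - T a) - (b - T b)))\<^sup>2"
proof -
  define p q where "p = T a - T b" and "q = (a - T a) - (b - T b)"
  have "norm (T a - T b) \<le> norm (a - b)"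
    using assms unfolding nonexpansive_def by blast
  moreover have "a - b = p + q" by (simp add: p_def q_def)
  ultimately have "(norm p)\<^sup>2 \<le> (norm (p + q))\<^sup>2"
    by (simp add: p_def power_mono)
  then show ?thesis
    unfolding p_def [symmetric] q_def [symmetric] power2_norm_eq_inner
    by (simp add: inner_simps inner_commute)
qed

locale fast_KM =
  fixes T :: "'a::{real_inner,complete_space} \<Rightarrow> 'a"
    and x :: "int \<Rightarrow> 'a"
    and \<eta> \<sigma> \<alpha> :: real
  assumes nonexp: "nonexpansive T"
    and Fix_nonempty: "Fix T \<noteq> {}"
    and \<eta>: "0 < \<eta>" "\<eta> < 1"
    and \<sigma>: "0 < \<sigma>"
    and \<alpha>: "2 \<le> \<alpha>"
    and iteration: "fast_KM_iteration T \<eta> \<sigma> \<alpha> x"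
begin

text \<open>
  This equals \<open>(1 - \<eta>) + \<eta> (\<alpha> - 1)\<close>, in a form that shows \<open>\<theta> \<ge> 1\<close> with equality only for \<open>\<alpha> = 2\<close>.
\<close>

definition \<theta> :: real where "\<theta> = 1 + \<eta> * (\<alpha> - 2)"

definition y :: "nat \<Rightarrow> 'a" where "y k = T (x (int k))"

definition v :: "nat \<Rightarrow> 'a" where "v k = T (x (int k)) - T (x (int k - 1))"

definition r :: "nat \<Rightarrow> 'a" where "r k = x (int k) - T (x (int k))"

definition E :: "'a \<Rightarrow> real \<Rightarrow> real \<Rightarrow> nat \<Rightarrow> real" where
  "E z \<mu> c k = energy \<alpha> \<theta> \<mu> c (real k + \<sigma>) (y k - z) (v k) (r k)"

lemma \<theta>_ge_1: "1 \<le> \<theta>"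
  unfolding \<theta>_def using \<alpha> \<eta> by simp

lemma x_eq: "x (int k) = y k + r k"
  by (simp add: y_def r_def)

lemma y_Suc: "y (Suc k) = y k + v (Suc k)"
  by (simp add: y_def v_def)

lemma increment_eq: "x (int (Suc k)) - x (int k) = v (Suc k) + r (Suc k) - r k"
  by (simp add: v_def r_def)

lemma recurrence:
  "(real k + \<sigma>) *\<^sub>R (v (Suc k) + r (Suc k)) = (real k + \<sigma> - \<alpha>) *\<^sub>R v k + (real k + \<sigma> - \<theta>) *\<^sub>R r k"
proof -
  define t where "t = real k + \<sigma>"
  have t: "0 < t" unfolding t_def using \<sigma> by simp
  have "x (int (Suc k)) = x (int k) - (\<theta> / t) *\<^sub>R r k + (1 - \<alpha> / t) *\<^sub>R v k"
  proof -
    have "(1 - \<eta>) + \<eta> * (\<alpha> - 1) = \<theta>" unfolding \<theta>_def by (simp add: algebra_simps)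
    then have "x (int k + 1) = x (int k) + (\<theta> / t) *\<^sub>R (T (x (int k)) - x (int k))
        + (1 - \<alpha> / t) *\<^sub>R (T (x (int k)) - T (x (int k - 1)))"
      using iteration unfolding fast_KM_iteration_def Let_def t_def by simp
    moreover have "T (x (int k)) - x (int k) = - r k" by (simp add: r_def)
    ultimately show ?thesis by (simp add: v_def add.commute)
  qed
  moreover have "v (Suc k) + r (Suc k) = (x (int (Suc k)) - x (int k)) + r k"
    unfolding increment_eq by simp
  ultimately have "v (Suc k) + r (Suc k) = r k - (\<theta> / t) *\<^sub>R r k + (1 - \<alpha> / t) *\<^sub>R v k"
    by simp
  then have "t *\<^sub>R (v (Suc k) + r (Suc k)) = t *\<^sub>R (r k - (\<theta> / t) *\<^sub>R r k + (1 - \<alpha> / t) *\<^sub>R v k)"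
    by simp
  also have "\<dots> = (t - \<alpha>) *\<^sub>R v k + (t - \<theta>) *\<^sub>R r k"
  proof -
    have "t * (1 - \<alpha> / t) = t - \<alpha>" "t * (\<theta> / t) = \<theta>" using t by (auto simp: field_simps)
    then show ?thesis using t by (simp add: scaleR_right_diff_distrib scaleR_right_distrib
          scaleR_left_diff_distrib)
  qed
  finally show ?thesis unfolding t_def .
qed

lemma cocoercive_step:
  "0 \<le> inner (r (Suc k) - r k) (v (Suc k)) + 1 / 2 * (norm (r (Suc k) - r k))\<^sup>2"
  using residual_cocoercive [OF nonexp, of "x (int (Suc k))" "x (int k)"]
  by (simp add: r_def v_def)

lemma gap_nonneg:
  assumes "z \<in> Fix T"
  shows "0 \<le> gap (r k) (y k - z)"
  using residual_cocoercive [OF nonexp, of "x (int k)" z] assms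
  by (simp add: r_def y_def gap_def Fix_def)

lemma E_step:
  assumes "\<theta> \<le> real k + \<sigma>" "c \<le> 1"
  shows "E z \<mu> c (Suc k) + \<mu> * (\<theta> - 1) * gap (r (Suc k)) (y (Suc k) - z)
       \<le> E z \<mu> c k
         - (\<alpha> - 1 - \<mu>) * (real k + \<sigma> - (\<alpha> - 1) / 2) * (norm (v (Suc k)))\<^sup>2
         - (\<theta> - 1) * (c * (real k + \<sigma> - (\<theta> - 1) / 2) + (1 - c) * \<theta> / 2 - \<mu> / 2) * (norm (r (Suc k)))\<^sup>2
         + ((real k + \<sigma>) * (\<mu> - \<theta> - c * (\<alpha> - 2)) + c * (\<alpha> - 1) * (\<theta> - 1)) * inner (v (Suc k)) (r (Suc k))"
proof -
  have nonneg: "0 \<le> real k + \<sigma>" using \<sigma> by simp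
  have eqs: "y k - z + v (Suc k) = y (Suc k) - z" "real k + \<sigma> + 1 = real (Suc k) + \<sigma>"
    by (simp_all add: y_Suc)
  show ?thesis
    using energy_step [OF recurrence [of k] cocoercive_step [of k] assms(1) nonneg assms(2),
        where \<mu> = \<mu> and d = "y k - z"]
    unfolding E_def eqs .
qed

text \<open>
  For \<open>\<alpha> = 2\<close> and \<open>\<mu> = 1\<close> the right-hand side of \<open>E_step\<close> is just the old energy. There is no damping to exploit, but
  the quadratic lower bound with \<open>c = 1/2\<close> already gives the rate.
\<close>

lemma residual_bigo_at_2:
  assumes "\<alpha> = 2"
  shows "(\<lambda>k. norm (r k)) \<in> O(\<lambda>k. 1 / real k)"
proof -
  have \<theta>1: "\<theta> = 1" unfolding \<theta>_def using assms by simp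
  obtain z where z: "z \<in> Fix T" using Fix_nonempty by blast
  define e where "e = E z 1 (1 / 2)"
  have dec: "e (Suc k) \<le> e k" if "1 \<le> k" for k
    using E_step [of k "1 / 2" z 1] that \<sigma> unfolding e_def \<theta>1 by (simp add: assms)
  have e_le: "e k \<le> e 1" if "1 \<le> k" for k
    using that
  proof (induction k rule: dec_induct)
    case (step n)
    then show ?case using dec [of n] by linarith
  qed simp
  have bound: "norm (r k) \<le> sqrt (32 * e 1) * (1 / real k)" if k: "2 \<le> k" for k
  proof -
    have "0 \<le> gap (r k) (y k - z)" using gap_nonneg z .
    then have "0 \<le> 1 / 2 * (real k + \<sigma> - 1) * gap (r k) (y k - z)"
      using k \<sigma> by (intro mult_nonneg_nonneg) auto
    moreover have "e k = 1 / 2 * (norm (y k - z + (real k + \<sigma> - 2) *\<^sub>R v k + (1 / 2 * (real k + \<sigma> - 1)) *\<^sub>R r k))\<^sup>2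
        + 1 / 2 * (real k + \<sigma> - 1) * gap (r k) (y k - z)
        + (real k + \<sigma> - 1) / 4 * (1 / 2 * (real k + \<sigma> - 1)) * (norm (r k))\<^sup>2"
      unfolding e_def E_def energy_square_form \<theta>1 by (simp add: assms)
    ultimately have "(real k + \<sigma> - 1) / 4 * (1 / 2 * (real k + \<sigma> - 1)) * (norm (r k))\<^sup>2 \<le> e 1"
      using e_le [of k] k
        zero_le_power2 [of "norm (y k - z + (real k + \<sigma> - 2) *\<^sub>R v k + (1 / 2 * (real k + \<sigma> - 1)) *\<^sub>R r k)"]
      by linarith
    moreover have "(real k / 2)\<^sup>2 * (norm (r k))\<^sup>2 \<le> (real k + \<sigma> - 1)\<^sup>2 * (norm (r k))\<^sup>2"
      using k \<sigma> by (intro mult_right_mono power_mono) auto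
    ultimately have "(real k * norm (r k))\<^sup>2 \<le> 32 * e 1"
      by (simp add: power2_eq_square field_simps)
    then have "real k * norm (r k) \<le> sqrt (32 * e 1)"
      by (rule real_le_rsqrt)
    then show ?thesis using k by (simp add: field_simps)
  qed
  then have "\<forall>\<^sub>F k in sequentially. norm (norm (r k)) \<le> sqrt (32 * e 1) * norm (1 / real k)"
    by (intro eventually_sequentiallyI [of 2]) auto
  then show ?thesis by (rule bigoI)
qed

section \<open>Dissipation for parameters above two\<close>

text \<open>
  From here on \<open>\<alpha> > 2\<close>. With \<open>c = (1 - \<eta>)/2\<close> the critical value \<open>\<mu> = \<theta> + c (\<alpha> - 2)\<close> equals
  \<open>\<alpha> - 1 - (1 - \<eta>)(\<alpha> - 2)/2\<close>, so it stays below \<open>\<alpha> - 1\<close> and the velocity damping is positive;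
  the residual damping is \<open>c (\<theta> - 1) = (1 - \<eta>) \<eta> (\<alpha> - 2)/2\<close>. The number \<open>\<epsilon>\<close> is a quarter of
  the smaller of the two, which leaves room to move \<open>\<mu>\<close> by up to \<open>\<epsilon>\<close> and still dissipate at
  rate \<open>\<epsilon>\<close>.
\<close>

context
  assumes \<alpha>2: "2 < \<alpha>"
begin

definition c :: real where "c = (1 - \<eta>) / 2"

definition \<epsilon> :: real where "\<epsilon> = (1 - \<eta>) * \<eta> * (\<alpha> - 2) / 8"

definition \<mu> :: "real \<Rightarrow> real" where "\<mu> \<delta> = \<theta> + c * (\<alpha> - 2) + \<delta>"

lemma c_bounds: "0 < c" "c < 1"
  unfolding c_def using \<eta> by auto

lemma \<epsilon>_pos: "0 < \<epsilon>"
  unfolding \<epsilon>_def using \<eta> \<alpha>2 by simp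

lemma \<theta>_gt_1: "1 < \<theta>"
  unfolding \<theta>_def using \<eta> \<alpha>2 by simp

lemma \<mu>_pos: "0 \<le> \<delta> \<Longrightarrow> 0 < \<mu> \<delta>"
  unfolding \<mu>_def using \<theta>_gt_1 c_bounds \<alpha>2 by (simp add: add_pos_nonneg)

lemma damping_r: "c * (\<theta> - 1) = 4 * \<epsilon>"
  unfolding c_def \<theta>_def \<epsilon>_def by simp

lemma damping_v:
  assumes "\<delta> \<le> \<epsilon>"
  shows "3 * \<epsilon> \<le> \<alpha> - 1 - \<mu> \<delta>"
proof -
  have "\<eta> * ((1 - \<eta>) * (\<alpha> - 2)) \<le> 1 * ((1 - \<eta>) * (\<alpha> - 2))"
    using \<eta> \<alpha>2 by (intro mult_right_mono) auto
  then have "4 * \<epsilon> \<le> (1 - \<eta>) * (\<alpha> - 2) / 2"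
    unfolding \<epsilon>_def by (simp only: mult.assoc mult.left_commute [of \<eta>])
  also have "\<dots> = \<alpha> - 1 - \<mu> 0"
    unfolding \<mu>_def \<theta>_def c_def by (simp add: field_simps)
  finally show ?thesis using assms unfolding \<mu>_def by simp
qed

definition dissipation :: "'a \<Rightarrow> real \<Rightarrow> nat \<Rightarrow> real" where
  "dissipation z \<delta> k = \<mu> \<delta> * (\<theta> - 1) * gap (r k) (y k - z)
     + \<epsilon> * (real k + \<sigma>) * ((norm (v k))\<^sup>2 + (norm (r k))\<^sup>2)"

lemma dissipation_nonneg:
  assumes "z \<in> Fix T" "0 \<le> \<delta>"
  shows "0 \<le> dissipation z \<delta> k"
proof -
  have "0 \<le> \<mu> \<delta> * (\<theta> - 1) * gap (r k) (y k - z)"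
    using \<mu>_pos [OF assms(2)] \<theta>_gt_1 gap_nonneg [OF assms(1)] by simp
  moreover have "0 \<le> \<epsilon> * (real k + \<sigma>) * ((norm (v k))\<^sup>2 + (norm (r k))\<^sup>2)"
    using \<epsilon>_pos \<sigma> by simp
  ultimately show ?thesis unfolding dissipation_def by linarith
qed

text \<open>
  The mixed term has coefficient \<open>t \<delta> + K\<close> with \<open>\<delta> \<le> \<epsilon>\<close> and a constant \<open>K\<close>; Young's inequality charges half
  of it to each damping term, and each term retains at least \<open>5/2 \<epsilon> t\<close> minus a constant. What is left exceeds
  \<open>\<epsilon> (t + 1)\<close> for large \<open>t\<close>, and \<open>t + 1\<close> is the value of \<open>t\<close> at the new index.
\<close>

lemma energy_descent:
  assumes \<delta>: "0 \<le> \<delta>" "\<delta> \<le> \<epsilon>"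
  shows "\<forall>\<^sub>F k in sequentially. E z (\<mu> \<delta>) c (Suc k) + dissipation z \<delta> (Suc k) \<le> E z (\<mu> \<delta>) c k"
proof -
  define A where "A = \<alpha> - 1 - \<mu> \<delta>"
  define K where "K = c * (\<alpha> - 1) * (\<theta> - 1)"
  \<comment> \<open>The part of the residual damping that does not grow with \<open>t\<close>.\<close>
  define M where "M = (\<theta> - 1) * ((1 - c) * \<theta> / 2 - \<mu> \<delta> / 2 - c * (\<theta> - 1) / 2)"
  have A: "3 * \<epsilon> \<le> A" unfolding A_def by (rule damping_v [OF \<delta>(2)])
  have K: "0 \<le> K" unfolding K_def using c_bounds \<alpha>2 \<theta>_gt_1 by simp
  have 1: "\<forall>\<^sub>F k in sequentially. \<theta> \<le> 1 * (real k + \<sigma>)"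
    by (rule eventually_linear_ge) simp
  have 2: "\<forall>\<^sub>F k in sequentially. A * (\<alpha> - 1) / 2 + K / 2 + \<epsilon> \<le> (A - \<delta> / 2 - \<epsilon>) * (real k + \<sigma>)"
    using A \<delta> \<epsilon>_pos by (intro eventually_linear_ge) linarith
  have 3: "\<forall>\<^sub>F k in sequentially. K / 2 + \<epsilon> - M \<le> (4 * \<epsilon> - \<delta> / 2 - \<epsilon>) * (real k + \<sigma>)"
    using \<delta> \<epsilon>_pos by (intro eventually_linear_ge) linarith
  from 1 2 3 show ?thesis
  proof eventually_elim
    case (elim k)
    define t where "t = real k + \<sigma>"
    have t: "0 < t" unfolding t_def using \<sigma> by simp
    define vv rr vr where "vv = (norm (v (Suc k)))\<^sup>2" and "rr = (norm (r (Suc k)))\<^sup>2"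
      and "vr = inner (v (Suc k)) (r (Suc k))"
    have nn: "0 \<le> vv" "0 \<le> rr" unfolding vv_def rr_def by simp_all
    have "0 \<le> (norm (v (Suc k) - r (Suc k)))\<^sup>2" by simp
    then have young: "vr \<le> (vv + rr) / 2"
      unfolding vv_def rr_def vr_def power2_norm_eq_inner
      by (simp add: inner_simps inner_commute)
    have "0 \<le> t * \<delta> + K" using t \<delta> K by simp
    then have cross: "(t * \<delta> + K) * vr \<le> (t * \<delta> + K) * ((vv + rr) / 2)"
      using young by (rule mult_left_mono [rotated])
    have "\<epsilon> * (t + 1) + (t * \<delta> + K) / 2 \<le> A * (t - (\<alpha> - 1) / 2)"
      using elim(2) unfolding t_def [symmetric] by (simp add: field_simps)
    then have av: "(\<epsilon> * (t + 1) + (t * \<delta> + K) / 2) * vv \<le> A * (t - (\<alpha> - 1) / 2) * vv"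
      using nn by (intro mult_right_mono)
    have "(\<theta> - 1) * (c * (t - (\<theta> - 1) / 2) + (1 - c) * \<theta> / 2 - \<mu> \<delta> / 2) = c * (\<theta> - 1) * t + M"
      unfolding M_def by (simp add: field_simps)
    then have "(\<theta> - 1) * (c * (t - (\<theta> - 1) / 2) + (1 - c) * \<theta> / 2 - \<mu> \<delta> / 2) = 4 * \<epsilon> * t + M"
      unfolding damping_r .
    moreover have "\<epsilon> * (t + 1) + (t * \<delta> + K) / 2 \<le> 4 * \<epsilon> * t + M"
      using elim(3) unfolding t_def [symmetric] by (simp add: field_simps)
    ultimately have ar: "(\<epsilon> * (t + 1) + (t * \<delta> + K) / 2) * rr
        \<le> (\<theta> - 1) * (c * (t - (\<theta> - 1) / 2) + (1 - c) * \<theta> / 2 - \<mu> \<delta> / 2) * rr"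
      using nn by (intro mult_right_mono) auto
    have "t * (\<mu> \<delta> - \<theta> - c * (\<alpha> - 2)) + c * (\<alpha> - 1) * (\<theta> - 1) = t * \<delta> + K"
      unfolding \<mu>_def K_def by simp
    then have "E z (\<mu> \<delta>) c (Suc k) + \<mu> \<delta> * (\<theta> - 1) * gap (r (Suc k)) (y (Suc k) - z)
        \<le> E z (\<mu> \<delta>) c k - A * (t - (\<alpha> - 1) / 2) * vv
         - (\<theta> - 1) * (c * (t - (\<theta> - 1) / 2) + (1 - c) * \<theta> / 2 - \<mu> \<delta> / 2) * rr
         + (t * \<delta> + K) * vr"
      using E_step [of k c z "\<mu> \<delta>"] elim(1) c_bounds
      unfolding A_def vv_def rr_def vr_def t_def by simp
    moreover have "dissipation z \<delta> (Suc k) = \<mu> \<delta> * (\<theta> - 1) * gap (r (Suc k)) (y (Suc k) - z)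
        + \<epsilon> * (t + 1) * (vv + rr)"
      unfolding dissipation_def vv_def rr_def t_def by (simp add: add_ac)
    moreover have "\<epsilon> * (t + 1) * (vv + rr) + (t * \<delta> + K) * ((vv + rr) / 2)
        = (\<epsilon> * (t + 1) + (t * \<delta> + K) / 2) * vv + (\<epsilon> * (t + 1) + (t * \<delta> + K) / 2) * rr"
      by (simp add: field_simps)
    ultimately show ?case using av ar cross by linarith
  qed
qed

text \<open>
  For \<open>\<delta> \<le> \<epsilon>\<close> the factor of \<open>|y - z|\<^sup>2\<close> is positive, since then \<open>\<mu> \<delta> < \<alpha> - 1\<close>; this is what
  bounds the iterates.
\<close>

lemma energy_lower_bound:
  assumes z: "z \<in> Fix T" and \<delta>: "0 \<le> \<delta>"
  shows "\<forall>\<^sub>F k in sequentially. \<mu> \<delta> * (\<alpha> - 1 - \<mu> \<delta>) / 2 * (norm (y k - z))\<^sup>2 \<le> E z (\<mu> \<delta>) c k"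
proof -
  have "\<forall>\<^sub>F k in sequentially. \<mu> \<delta> - \<theta> + c * \<theta> \<le> c * (real k + \<sigma>)"
    using c_bounds by (intro eventually_linear_ge)
  moreover have "\<forall>\<^sub>F k in sequentially. \<theta> \<le> 1 * (real k + \<sigma>)"
    by (rule eventually_linear_ge) simp
  ultimately show ?thesis
  proof eventually_elim
    case (elim k)
    have "0 \<le> \<theta> - \<mu> \<delta> + c * (real k + \<sigma> - \<theta>)" using elim(1) by (simp add: algebra_simps)
    then have "0 \<le> (1 - c) * (real k + \<sigma> - \<theta>) / 2 * (\<theta> - \<mu> \<delta> + c * (real k + \<sigma> - \<theta>)) * (norm (r k))\<^sup>2"
      using c_bounds elim(2) by (intro mult_nonneg_nonneg) auto
    moreover have "0 \<le> \<mu> \<delta> * (1 - c) * (real k + \<sigma> - \<theta>) * gap (r k) (y k - z)"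
      using c_bounds elim(2) \<mu>_pos [OF \<delta>] gap_nonneg [OF z] by (intro mult_nonneg_nonneg) auto
    moreover have "0 \<le> (norm (\<mu> \<delta> *\<^sub>R (y k - z) + (real k + \<sigma> - \<alpha>) *\<^sub>R v k
        + (c * (real k + \<sigma> - \<theta>)) *\<^sub>R r k))\<^sup>2"
      by simp
    ultimately show ?case
      unfolding E_def energy_square_form by linarith
  qed
qed

lemma energy_nonneg:
  assumes "z \<in> Fix T" "0 \<le> \<delta>" "\<delta> \<le> \<epsilon>"
  shows "\<forall>\<^sub>F k in sequentially. 0 \<le> E z (\<mu> \<delta>) c k"
proof -
  have "0 \<le> \<mu> \<delta> * (\<alpha> - 1 - \<mu> \<delta>) / 2"
    using \<mu>_pos [OF assms(2)] damping_v [OF assms(3)] \<epsilon>_pos by (intro divide_nonneg_pos mult_nonneg_nonneg) auto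
  then have "0 \<le> \<mu> \<delta> * (\<alpha> - 1 - \<mu> \<delta>) / 2 * (norm (y k - z))\<^sup>2" for k
    by simp
  then show ?thesis
    by (intro eventually_mono [OF energy_lower_bound [OF assms(1,2)]]) (rule order_trans)
qed

lemma energy_convergent:
  assumes "z \<in> Fix T" "0 \<le> \<delta>" "\<delta> \<le> \<epsilon>"
  shows "convergent (E z (\<mu> \<delta>) c)"
  by (rule descent_convergent_summable(1) [OF energy_descent energy_nonneg])
    (use assms dissipation_nonneg in auto)

lemma dissipation_summable:
  assumes "z \<in> Fix T"
  shows "summable (dissipation z 0)"
  by (rule descent_convergent_summable(2) [OF energy_descent energy_nonneg])
    (use assms \<epsilon>_pos dissipation_nonneg in auto)

lemma gap_summable:
  assumes z: "z \<in> Fix T"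
  shows "summable (\<lambda>k. gap (r k) (y k - z))"
proof -
  have p: "0 < \<mu> 0 * (\<theta> - 1)" using \<mu>_pos \<theta>_gt_1 by simp
  have "summable (\<lambda>k. \<mu> 0 * (\<theta> - 1) * gap (r k) (y k - z))"
  proof (rule summable_comparison_test_ev [OF always_eventually dissipation_summable [OF z]], intro allI)
    fix k
    have "0 \<le> \<epsilon> * (real k + \<sigma>) * ((norm (v k))\<^sup>2 + (norm (r k))\<^sup>2)"
      using \<epsilon>_pos \<sigma> by simp
    then show "norm (\<mu> 0 * (\<theta> - 1) * gap (r k) (y k - z)) \<le> dissipation z 0 k"
      unfolding dissipation_def using p gap_nonneg [OF z, of k] by simp
  qed
  then have "\<mu> 0 * (\<theta> - 1) = 0 \<or> summable (\<lambda>k. gap (r k) (y k - z))"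
    by (rule iffD1 [OF summable_cmult_iff])
  then show ?thesis using p by auto
qed

lemma weighted_squares_summable:
  "summable (\<lambda>k. (real k + \<sigma>) * ((norm (v k))\<^sup>2 + (norm (r k))\<^sup>2))"
proof -
  obtain z where z: "z \<in> Fix T" using Fix_nonempty by blast
  have p: "0 < \<mu> 0 * (\<theta> - 1)" using \<mu>_pos \<theta>_gt_1 by simp
  have "summable (\<lambda>k. \<epsilon> * ((real k + \<sigma>) * ((norm (v k))\<^sup>2 + (norm (r k))\<^sup>2)))"
  proof (rule summable_comparison_test_ev [OF always_eventually dissipation_summable [OF z]], intro allI)
    fix k
    have "0 \<le> \<epsilon> * ((real k + \<sigma>) * ((norm (v k))\<^sup>2 + (norm (r k))\<^sup>2))"
      using \<epsilon>_pos \<sigma> by simp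
    moreover have "0 \<le> \<mu> 0 * (\<theta> - 1) * gap (r k) (y k - z)"
      using p gap_nonneg [OF z, of k] by simp
    ultimately show "norm (\<epsilon> * ((real k + \<sigma>) * ((norm (v k))\<^sup>2 + (norm (r k))\<^sup>2))) \<le> dissipation z 0 k"
      unfolding dissipation_def by (simp add: mult.assoc)
  qed
  then have "\<epsilon> = 0 \<or> summable (\<lambda>k. (real k + \<sigma>) * ((norm (v k))\<^sup>2 + (norm (r k))\<^sup>2))"
    by (rule iffD1 [OF summable_cmult_iff])
  then show ?thesis using \<epsilon>_pos by simp
qed

lemma residual_squares_summable: "summable (\<lambda>k. real k * (norm (r k))\<^sup>2)"
proof (rule summable_comparison_test_ev [OF always_eventually weighted_squares_summable], intro allI)
  fix k
  have "real k * (norm (r k))\<^sup>2 \<le> (real k + \<sigma>) * ((norm (v k))\<^sup>2 + (norm (r k))\<^sup>2)"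
    using \<sigma> by (intro mult_mono) auto
  then show "norm (real k * (norm (r k))\<^sup>2) \<le> (real k + \<sigma>) * ((norm (v k))\<^sup>2 + (norm (r k))\<^sup>2)"
    by simp
qed

text \<open>
  The increment is \<open>v\<^sub>k\<^sub>+\<^sub>1 + r\<^sub>k\<^sub>+\<^sub>1 - r\<^sub>k\<close>, so its square is controlled by the weighted squares at two
  consecutive indices.
\<close>

lemma increment_squares_summable:
  "summable (\<lambda>k. real k * (norm (x (int k) - x (int k - 1)))\<^sup>2)"
proof -
  define b where "b k = (real k + \<sigma>) * ((norm (v k))\<^sup>2 + (norm (r k))\<^sup>2)" for k
  have b: "summable b" unfolding b_def by (rule weighted_squares_summable)
  have "summable (\<lambda>k. real (Suc k) * (norm (x (int (Suc k)) - x (int k)))\<^sup>2)"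
  proof (rule summable_comparison_test_ev)
    show "summable (\<lambda>k. 3 * b (Suc k) + 6 * b k)"
      using b iffD2 [OF summable_Suc_iff b] by (intro summable_add summable_mult)
    have "norm (real (Suc k) * (norm (x (int (Suc k)) - x (int k)))\<^sup>2) \<le> 3 * b (Suc k) + 6 * b k"
      if k: "1 \<le> k" for k
    proof -
      have three: "(norm (p + q - w))\<^sup>2 \<le> 3 * ((norm p)\<^sup>2 + (norm q)\<^sup>2) + 3 * (norm w)\<^sup>2"
        for p q w :: 'a
      proof -
        have "0 \<le> (norm (p - q))\<^sup>2 + (norm (p + w))\<^sup>2 + (norm (q + w))\<^sup>2" by simp
        then show ?thesis
          unfolding power2_norm_eq_inner by (simp add: inner_simps inner_commute)
      qed
      have "real (Suc k) * (norm (x (int (Suc k)) - x (int k)))\<^sup>2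
          \<le> real (Suc k) * (3 * ((norm (v (Suc k)))\<^sup>2 + (norm (r (Suc k)))\<^sup>2) + 3 * (norm (r k))\<^sup>2)"
        unfolding increment_eq by (intro mult_left_mono three) simp
      also have "\<dots> = 3 * (real (Suc k) * ((norm (v (Suc k)))\<^sup>2 + (norm (r (Suc k)))\<^sup>2))
          + 3 * (real (Suc k) * (norm (r k))\<^sup>2)"
        by (simp add: algebra_simps)
      also have "\<dots> \<le> 3 * b (Suc k) + 3 * (2 * b k)"
      proof (intro add_mono mult_left_mono)
        show "real (Suc k) * ((norm (v (Suc k)))\<^sup>2 + (norm (r (Suc k)))\<^sup>2) \<le> b (Suc k)"
          unfolding b_def using \<sigma> by (intro mult_right_mono) auto
        have "real (Suc k) * (norm (r k))\<^sup>2 \<le> (2 * (real k + \<sigma>)) * ((norm (v k))\<^sup>2 + (norm (r k))\<^sup>2)"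
          using k \<sigma> by (intro mult_mono) auto
        then show "real (Suc k) * (norm (r k))\<^sup>2 \<le> 2 * b k" unfolding b_def by (simp only: mult.assoc)
      qed auto
      finally show ?thesis by simp
    qed
    then show "\<forall>\<^sub>F k in sequentially. norm (real (Suc k) * (norm (x (int (Suc k)) - x (int k)))\<^sup>2)
        \<le> 3 * b (Suc k) + 6 * b k"
      by (intro eventually_sequentiallyI [of 1])
  qed
  then have "summable (\<lambda>k. real (Suc k) * (norm (x (int (Suc k)) - x (int (Suc k) - 1)))\<^sup>2)"
    by simp
  then show ?thesis by (rule iffD1 [OF summable_Suc_iff])
qed

section \<open>Limits and rates of convergence\<close>

text \<open>
  This quantity is the difference quotient in \<open>\<mu>\<close> of two convergent energies.
\<close>

lemma correlation_convergent:
  assumes z: "z \<in> Fix T"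
  shows "convergent (\<lambda>k. (\<alpha> - 1) / 2 * (norm (y k - z))\<^sup>2
    + inner (y k - z) ((real k + \<sigma> - \<alpha>) *\<^sub>R v k + (real k + \<sigma> - \<theta>) *\<^sub>R r k))" (is "convergent ?P")
proof -
  have E: "E z (\<mu> \<delta>) c k = E z 0 c k + \<mu> \<delta> * ?P k" for \<delta> k
    unfolding E_def by (rule energy_affine)
  have "?P = (\<lambda>k. (E z (\<mu> \<epsilon>) c k - E z (\<mu> 0) c k) * (1 / \<epsilon>))"
  proof
    fix k
    have "E z (\<mu> \<epsilon>) c k - E z (\<mu> 0) c k = (\<mu> \<epsilon> - \<mu> 0) * ?P k"
      unfolding E by (simp add: left_diff_distrib)
    also have "\<dots> = ?P k * \<epsilon>" unfolding \<mu>_def by simp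
    finally show "?P k = (E z (\<mu> \<epsilon>) c k - E z (\<mu> 0) c k) * (1 / \<epsilon>)"
      using \<epsilon>_pos by simp
  qed
  moreover have "convergent \<dots>"
    using energy_convergent [OF z, of \<epsilon>] energy_convergent [OF z, of 0] \<epsilon>_pos
    by (intro convergent_mult convergent_diff convergent_const) auto
  ultimately show ?thesis by simp
qed

text \<open>
  The kinetic energy is what remains of a convergent energy after the correlation is removed, so it
  has a limit. It is at most \<open>t\<^sup>2 (|v|\<^sup>2 + |r|\<^sup>2)\<close>, and \<open>t (|v|\<^sup>2 + |r|\<^sup>2)\<close> is summable, which forces that limit
  to be zero.
\<close>

lemma kinetic_energy_tendsto_0: "E z 0 c \<longlonglongrightarrow> 0"
proof -
  \<comment> \<open>The kinetic energy ignores \<open>z\<close>, so it may be computed with a fixed point.\<close>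
  obtain z' where z': "z' \<in> Fix T" using Fix_nonempty by blast
  have "E z' (\<mu> 0) c k = E z 0 c k + \<mu> 0 * ((\<alpha> - 1) / 2 * (norm (y k - z'))\<^sup>2
    + inner (y k - z') ((real k + \<sigma> - \<alpha>) *\<^sub>R v k + (real k + \<sigma> - \<theta>) *\<^sub>R r k))" for k
    unfolding E_def by (subst energy_affine) (simp add: energy_def)
  then have "E z 0 c = (\<lambda>k. E z' (\<mu> 0) c k - \<mu> 0 * ((\<alpha> - 1) / 2 * (norm (y k - z'))\<^sup>2
    + inner (y k - z') ((real k + \<sigma> - \<alpha>) *\<^sub>R v k + (real k + \<sigma> - \<theta>) *\<^sub>R r k)))"
    by auto
  moreover have "convergent \<dots>"
    using energy_convergent [OF z', of 0] \<epsilon>_pos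
    by (intro convergent_diff convergent_mult convergent_const correlation_convergent z') auto
  ultimately obtain L where L: "E z 0 c \<longlonglongrightarrow> L"
    unfolding convergent_def by metis
  have \<theta>: "\<forall>\<^sub>F k in sequentially. \<theta> \<le> 1 * (real k + \<sigma>)"
    and \<alpha>': "\<forall>\<^sub>F k in sequentially. \<alpha> \<le> 1 * (real k + \<sigma>)"
    by (rule eventually_linear_ge, simp)+
  have "L = 0"
  proof (rule limit_zero_if_summable_div [OF L _ weighted_squares_summable _ \<sigma>])
    show "\<forall>\<^sub>F k in sequentially. 0 \<le> E z 0 c k" using \<theta>
    proof eventually_elim
      case (elim k)
      have "0 \<le> (1 - c) * (real k + \<sigma> - \<theta>) / 2 * (\<theta> - 0 + c * (real k + \<sigma> - \<theta>)) * (norm (r k))\<^sup>2"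
        using elim c_bounds \<theta>_gt_1 by (intro mult_nonneg_nonneg add_nonneg_nonneg) auto
      then show ?case unfolding E_def energy_square_form by simp
    qed
    show "\<forall>\<^sub>F k in sequentially. E z 0 c k
        \<le> (real k + \<sigma>) * ((real k + \<sigma>) * ((norm (v k))\<^sup>2 + (norm (r k))\<^sup>2))"
      using \<theta> \<alpha>'
    proof eventually_elim
      case (elim k)
      then have "E z 0 c k \<le> (real k + \<sigma>)\<^sup>2 * ((norm (v k))\<^sup>2 + (norm (r k))\<^sup>2)"
        unfolding E_def using c_bounds \<alpha>2 \<theta>_gt_1 by (intro kinetic_le) auto
      then show ?case by (simp add: power2_eq_square mult.assoc)
    qed
  qed
  with L show ?thesis by simp
qed

text \<open>
  For \<open>\<mu> = 0\<close> and \<open>t \<ge> \<theta>\<close> the square form of the energy is a sum of nonnegative terms, so each of them tends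
  to zero with the energy.
\<close>

lemma scaled_residual_tendsto_0: "(\<lambda>k. (real k + \<sigma> - \<theta>) *\<^sub>R r k) \<longlonglongrightarrow> 0"
  and scaled_momentum_tendsto_0:
    "(\<lambda>k. (real k + \<sigma> - \<alpha>) *\<^sub>R v k + (c * (real k + \<sigma> - \<theta>)) *\<^sub>R r k) \<longlonglongrightarrow> 0" (is "?V \<longlonglongrightarrow> 0")
proof -
  define W where "W = E 0 0 c"
  have W: "W \<longlonglongrightarrow> 0" unfolding W_def by (rule kinetic_energy_tendsto_0)
  define R where "R k = (real k + \<sigma> - \<theta>) *\<^sub>R r k" for k
  have "\<forall>\<^sub>F k in sequentially. \<theta> \<le> 1 * (real k + \<sigma>)"
    by (rule eventually_linear_ge) simp
  then have ev: "\<forall>\<^sub>F k in sequentially. c * (1 - c) / 2 * (norm (R k))\<^sup>2 + 1 / 2 * (norm (?V k))\<^sup>2 \<le> W k"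
  proof eventually_elim
    case (elim k)
    define s where "s = real k + \<sigma> - \<theta>"
    have "0 \<le> (1 - c) * s / 2 * \<theta> * (norm (r k))\<^sup>2"
      using elim c_bounds \<theta>_gt_1 unfolding s_def by (intro mult_nonneg_nonneg) auto
    moreover have "c * (1 - c) / 2 * (norm (R k))\<^sup>2 = c * (1 - c) / 2 * (s * s * (norm (r k))\<^sup>2)"
      unfolding R_def s_def by (simp add: power_mult_distrib power2_eq_square)
    moreover have "W k = 1 / 2 * (norm (?V k))\<^sup>2 + (1 - c) * s / 2 * (\<theta> + c * s) * (norm (r k))\<^sup>2"
      unfolding W_def E_def energy_square_form s_def by simp
    moreover have "(1 - c) * s / 2 * (\<theta> + c * s) * (norm (r k))\<^sup>2
        = (1 - c) * s / 2 * \<theta> * (norm (r k))\<^sup>2 + c * (1 - c) / 2 * (s * s * (norm (r k))\<^sup>2)"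
      by (simp add: field_simps)
    ultimately show ?case by linarith
  qed
  have from_sq: "X \<longlonglongrightarrow> 0" if "0 < C" and le: "\<forall>\<^sub>F k in sequentially. C * (norm (X k))\<^sup>2 \<le> W k"
    for C and X :: "nat \<Rightarrow> 'a"
  proof -
    have "(\<lambda>k. (norm (X k))\<^sup>2) \<longlonglongrightarrow> 0"
    proof (rule tendsto_sandwich [OF _ _ tendsto_const])
      show "\<forall>\<^sub>F k in sequentially. (norm (X k))\<^sup>2 \<le> W k / C"
        using le by eventually_elim (use \<open>0 < C\<close> in \<open>simp add: field_simps\<close>)
      show "(\<lambda>k. W k / C) \<longlonglongrightarrow> 0"
        using tendsto_divide [OF W tendsto_const [of C]] \<open>0 < C\<close> by simp
    qed simp
    then have "(\<lambda>k. sqrt ((norm (X k))\<^sup>2)) \<longlonglongrightarrow> sqrt 0" by (rule tendsto_real_sqrt)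
    then show ?thesis by (simp add: tendsto_norm_zero_iff)
  qed
  have cc: "0 < c * (1 - c) / 2" using c_bounds by simp
  have "\<forall>\<^sub>F k in sequentially. c * (1 - c) / 2 * (norm (R k))\<^sup>2 \<le> W k"
    using ev
  proof (rule eventually_mono)
    fix k
    assume "c * (1 - c) / 2 * (norm (R k))\<^sup>2 + 1 / 2 * (norm (?V k))\<^sup>2 \<le> W k"
    then show "c * (1 - c) / 2 * (norm (R k))\<^sup>2 \<le> W k"
      using zero_le_power2 [of "norm (?V k)"] by linarith
  qed
  then have "R \<longlonglongrightarrow> 0" by (rule from_sq [OF cc])
  then show "(\<lambda>k. (real k + \<sigma> - \<theta>) *\<^sub>R r k) \<longlonglongrightarrow> 0" unfolding R_def .
  have "\<forall>\<^sub>F k in sequentially. 1 / 2 * (norm (?V k))\<^sup>2 \<le> W k"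
    using ev
  proof (rule eventually_mono)
    fix k
    assume "c * (1 - c) / 2 * (norm (R k))\<^sup>2 + 1 / 2 * (norm (?V k))\<^sup>2 \<le> W k"
    moreover have "0 \<le> c * (1 - c) / 2 * (norm (R k))\<^sup>2" using cc by simp
    ultimately show "1 / 2 * (norm (?V k))\<^sup>2 \<le> W k" by linarith
  qed
  then show "?V \<longlonglongrightarrow> 0" by (rule from_sq [rotated]) simp
qed

lemma scaled_velocity_tendsto_0: "(\<lambda>k. (real k + \<sigma> - \<alpha>) *\<^sub>R v k) \<longlonglongrightarrow> 0"
  using tendsto_diff [OF scaled_momentum_tendsto_0 tendsto_scaleR [OF tendsto_const [of c] scaled_residual_tendsto_0]]
  by simp

text \<open>
  The weights \<open>t - \<theta>\<close> and \<open>t - \<alpha>\<close> of the energy are comparable to \<open>k\<close>.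
\<close>

lemma shifted_scaling_tendsto_0:
  fixes X :: "nat \<Rightarrow> 'a"
  assumes "(\<lambda>k. (real k + \<sigma> - s) *\<^sub>R X k) \<longlonglongrightarrow> 0"
  shows "(\<lambda>k. real k *\<^sub>R X k) \<longlonglongrightarrow> 0"
proof (rule Lim_null_comparison)
  have "\<forall>\<^sub>F k in sequentially. s \<le> 1 / 2 * (real k + 0)"
    by (rule eventually_linear_ge) simp
  then show "\<forall>\<^sub>F k in sequentially. norm (real k *\<^sub>R X k) \<le> 2 * norm ((real k + \<sigma> - s) *\<^sub>R X k)"
  proof eventually_elim
    case (elim k)
    then have "real k \<le> 2 * \<bar>real k + \<sigma> - s\<bar>" using \<sigma> by simp
    then have "real k * norm (X k) \<le> 2 * \<bar>real k + \<sigma> - s\<bar> * norm (X k)" by (rule mult_right_mono) simp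
    then show ?case by simp
  qed
  show "(\<lambda>k. 2 * norm ((real k + \<sigma> - s) *\<^sub>R X k)) \<longlonglongrightarrow> 0"
    using tendsto_mult [OF tendsto_const [of 2] tendsto_norm [OF assms]] by simp
qed

lemma residual_rate: "(\<lambda>k. real k *\<^sub>R r k) \<longlonglongrightarrow> 0"
  by (rule shifted_scaling_tendsto_0 [OF scaled_residual_tendsto_0])

lemma velocity_rate: "(\<lambda>k. real k *\<^sub>R v k) \<longlonglongrightarrow> 0"
  by (rule shifted_scaling_tendsto_0 [OF scaled_velocity_tendsto_0])

lemma residual_tendsto_0: "r \<longlonglongrightarrow> 0"
proof (rule Lim_null_comparison)
  show "\<forall>\<^sub>F k in sequentially. norm (r k) \<le> norm (real k *\<^sub>R r k)"
    using eventually_ge_at_top [of 1]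
  proof eventually_elim
    case (elim k)
    then have "1 * norm (r k) \<le> real k * norm (r k)" by (intro mult_right_mono) auto
    then show ?case by simp
  qed
  show "(\<lambda>k. norm (real k *\<^sub>R r k)) \<longlonglongrightarrow> 0"
    using tendsto_norm [OF residual_rate] by simp
qed

lemma increment_rate: "(\<lambda>k. real k *\<^sub>R (x (int k) - x (int k - 1))) \<longlonglongrightarrow> 0"
proof -
  have "(\<lambda>k. real (Suc k) *\<^sub>R v (Suc k) + real (Suc k) *\<^sub>R r (Suc k) - (real k *\<^sub>R r k + r k)) \<longlonglongrightarrow> 0 + 0 - (0 + 0)"
    by (intro tendsto_add tendsto_diff residual_rate residual_tendsto_0
        LIMSEQ_Suc [OF velocity_rate] LIMSEQ_Suc [OF residual_rate])
  moreover have "real (Suc k) *\<^sub>R v (Suc k) + real (Suc k) *\<^sub>R r (Suc k) - (real k *\<^sub>R r k + r k)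
      = real (Suc k) *\<^sub>R (x (int (Suc k)) - x (int (Suc k) - 1))" for k
  proof -
    have increment: "x (int (Suc k)) - x (int (Suc k) - 1) = v (Suc k) + r (Suc k) - r k"
      using increment_eq [of k] by simp
    show ?thesis unfolding increment by (simp add: algebra_simps)
  qed
  ultimately have "(\<lambda>k. real (Suc k) *\<^sub>R (x (int (Suc k)) - x (int (Suc k) - 1))) \<longlonglongrightarrow> 0"
    by simp
  then show ?thesis by (rule LIMSEQ_imp_Suc)
qed

lemma y_bounded:
  assumes z: "z \<in> Fix T"
  shows "Bseq (\<lambda>k. y k - z)"
proof -
  define p where "p = \<mu> 0 * (\<alpha> - 1 - \<mu> 0) / 2"
  have p: "0 < p" unfolding p_def using \<mu>_pos [of 0] damping_v [of 0] \<epsilon>_pos by simp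
  obtain M where M: "\<And>k. norm (E z (\<mu> 0) c k) \<le> M"
    using convergent_imp_Bseq [OF energy_convergent [OF z, of 0]] \<epsilon>_pos unfolding Bseq_def by auto
  have "\<forall>\<^sub>F k in sequentially. norm (y k - z) \<le> sqrt (M / p)"
    using energy_lower_bound [OF z order_refl] unfolding p_def [symmetric]
  proof eventually_elim
    case (elim k)
    then have "p * (norm (y k - z))\<^sup>2 \<le> M" using M [of k] by simp
    then have "(norm (y k - z))\<^sup>2 \<le> M / p" using p by (simp add: field_simps)
    then show ?case by (rule real_le_rsqrt)
  qed
  then show ?thesis by (rule BfunI)
qed

lemma gap_rate:
  assumes z: "z \<in> Fix T"
  shows "(\<lambda>k. real k * gap (r k) (y k - z)) \<longlonglongrightarrow> 0"
proof -
  have "(\<lambda>k. inner (real k *\<^sub>R r k) (y k - z)) \<longlonglongrightarrow> 0"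
    using residual_rate y_bounded [OF z]
    unfolding tendsto_Zfun_iff diff_zero
    by (rule bounded_bilinear.Zfun_prod_Bfun [OF bounded_bilinear_inner])
  moreover have "(\<lambda>k. 1 / 2 * inner (real k *\<^sub>R r k) (r k)) \<longlonglongrightarrow> 1 / 2 * inner 0 (0::'a)"
    by (intro tendsto_intros residual_rate residual_tendsto_0)
  ultimately have "(\<lambda>k. inner (real k *\<^sub>R r k) (y k - z) + 1 / 2 * inner (real k *\<^sub>R r k) (r k)) \<longlonglongrightarrow> 0 + 1 / 2 * inner 0 (0::'a)"
    by (rule tendsto_add)
  then show ?thesis by (simp add: gap_def power2_norm_eq_inner algebra_simps)
qed

text \<open>
  The correlation \<open>(\<alpha> - 1)/2 |y - z|\<^sup>2 + \<langle>y - z, Q\<rangle>\<close> converges and \<open>Q\<close> tends to zero, so \<open>|y - z|\<close>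
  converges. Passing to \<open>x\<close> adds twice the gap, which tends to zero.
\<close>

lemma distance_convergent:
  assumes z: "z \<in> Fix T"
  shows "convergent (\<lambda>k. (norm (x (int k) - z))\<^sup>2)"
proof -
  define Q where "Q k = (real k + \<sigma> - \<alpha>) *\<^sub>R v k + (real k + \<sigma> - \<theta>) *\<^sub>R r k" for k
  have Q: "Q \<longlonglongrightarrow> 0" unfolding Q_def
    using tendsto_add [OF scaled_velocity_tendsto_0 scaled_residual_tendsto_0] by simp
  have "(\<lambda>k. inner (Q k) (y k - z)) \<longlonglongrightarrow> 0"
    using Q y_bounded [OF z]
    unfolding tendsto_Zfun_iff diff_zero
    by (rule bounded_bilinear.Zfun_prod_Bfun [OF bounded_bilinear_inner])
  then have cross: "convergent (\<lambda>k. inner (Q k) (y k - z))" by (rule convergentI)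
  have "convergent (\<lambda>k. (\<alpha> - 1) / 2 * (norm (y k - z))\<^sup>2 + inner (Q k) (y k - z))"
    using correlation_convergent [OF z] by (simp add: Q_def inner_commute)
  then have "convergent (\<lambda>k. ((\<alpha> - 1) / 2 * (norm (y k - z))\<^sup>2 + inner (Q k) (y k - z) - inner (Q k) (y k - z))
      * (2 / (\<alpha> - 1)))"
    by (intro convergent_mult convergent_diff cross convergent_const)
  then have "convergent (\<lambda>k. (norm (y k - z))\<^sup>2)" using \<alpha>2 by simp
  moreover have "convergent (\<lambda>k. gap (r k) (y k - z))"
    using summable_LIMSEQ_zero [OF gap_summable [OF z]] by (rule convergentI)
  ultimately have "convergent (\<lambda>k. (norm (y k - z))\<^sup>2 + 2 * gap (r k) (y k - z))"
    by (intro convergent_add convergent_mult convergent_const)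
  moreover have "(norm (y k - z))\<^sup>2 + 2 * gap (r k) (y k - z) = (norm (x (int k) - z))\<^sup>2" for k
    unfolding x_eq gap_def power2_norm_eq_inner by (simp add: inner_simps inner_commute)
  ultimately show ?thesis by simp
qed

lemma weak_convergence: "\<exists>p\<in>Fix T. weakly_converges_to (\<lambda>k. x (int k)) p"
proof (rule opial_weak_convergence [OF nonexp _ Fix_nonempty distance_convergent])
  show "(\<lambda>k. x (int k) - T (x (int k))) \<longlonglongrightarrow> 0"
    using residual_tendsto_0 unfolding r_def .
qed

end

end

section \<open>Rates and weak convergence of the iteration\<close>

theorem theorem3p3:
  fixes T :: "'a::{real_inner,complete_space} \<Rightarrow> 'a"
    and x :: "int \<Rightarrow> 'a"
    and \<eta> \<sigma> \<alpha> :: real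
  assumes "nonexpansive T"
    and "Fix T \<noteq> {}"
    and "0 < \<eta>" and "\<eta> < 1"
    and "\<sigma> > 0"
    and "\<alpha> \<ge> 2"
    and "fast_KM_iteration T \<eta> \<sigma> \<alpha> x"
  shows "(\<lambda>k::nat. norm (x (int k) - T (x (int k)))) \<in> O(\<lambda>k. 1 / real k)
    \<and> (\<alpha> > 2 \<longrightarrow> (\<forall>z\<in>Fix T.
          \<comment> \<open>(ii)\<close>
          (summable (\<lambda>k::nat. inner (x (int k) - T (x (int k))) (T (x (int k)) - z)
                       + 1 / 2 * (norm (x (int k) - T (x (int k))))\<^sup>2)
           \<and> summable (\<lambda>k::nat. real k * (norm (x (int k) - T (x (int k))))\<^sup>2)
           \<and> summable (\<lambda>k::nat. real k * (norm (x (int k) - x (int k - 1)))\<^sup>2))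
          \<comment> \<open>(iii)\<close>
        \<and> (\<exists>p\<in>Fix T. weakly_converges_to (\<lambda>k::nat. x (int k)) p)
          \<comment> \<open>(iv)\<close>
        \<and> ((\<lambda>k::nat. inner (x (int k) - T (x (int k))) (T (x (int k)) - z)
                       + 1 / 2 * (norm (x (int k) - T (x (int k))))\<^sup>2) \<in> o(\<lambda>k. 1 / real k)
           \<and> (\<lambda>k::nat. norm (x (int k) - x (int k - 1))) \<in> o(\<lambda>k. 1 / real k)
           \<and> (\<lambda>k::nat. norm (x (int k) - T (x (int k)))) \<in> o(\<lambda>k. 1 / real k))))"
proof -
  interpret fast_KM T x \<eta> \<sigma> \<alpha>
    by unfold_locales (use assms in auto)
  have residual: "(\<lambda>k. norm (r k)) \<in> o(\<lambda>k. 1 / real k)" if "2 < \<alpha>"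
    using tendsto_norm [OF residual_rate [OF that]] by (intro smallo_inverseI) simp
  have increment: "(\<lambda>k. norm (x (int k) - x (int k - 1))) \<in> o(\<lambda>k. 1 / real k)" if "2 < \<alpha>"
    using tendsto_norm [OF increment_rate [OF that]] by (intro smallo_inverseI) simp
  have gap: "(\<lambda>k. gap (r k) (y k - z)) \<in> o(\<lambda>k. 1 / real k)" if "2 < \<alpha>" "z \<in> Fix T" for z
    using gap_rate [OF that] by (rule smallo_inverseI)
  have "(\<lambda>k. norm (r k)) \<in> O(\<lambda>k. 1 / real k)"
  proof (cases "\<alpha> = 2")
    case True
    then show ?thesis by (rule residual_bigo_at_2)
  next
    case False
    then show ?thesis using \<alpha> residual landau_o.small_imp_big by force
  qed
  then show ?thesis
    unfolding r_def
  proof (intro conjI impI ballI)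
    fix z assume *: "2 < \<alpha>" "z \<in> Fix T"
    show "summable (\<lambda>k. inner (x (int k) - T (x (int k))) (T (x (int k)) - z)
        + 1 / 2 * (norm (x (int k) - T (x (int k))))\<^sup>2)"
      using gap_summable [OF *] unfolding gap_def r_def y_def .
    show "summable (\<lambda>k. real k * (norm (x (int k) - T (x (int k))))\<^sup>2)"
      using residual_squares_summable [OF *(1)] unfolding r_def .
    show "summable (\<lambda>k. real k * (norm (x (int k) - x (int k - 1)))\<^sup>2)"
      using increment_squares_summable [OF *(1)] .
    show "\<exists>p\<in>Fix T. weakly_converges_to (\<lambda>k. x (int k)) p"
      using weak_convergence [OF *(1)] .
    show "(\<lambda>k. inner (x (int k) - T (x (int k))) (T (x (int k)) - z)
        + 1 / 2 * (norm (x (int k) - T (x (int k))))\<^sup>2) \<in> o(\<lambda>k. 1 / real k)"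
      using gap [OF *] unfolding gap_def r_def y_def .
    show "(\<lambda>k. norm (x (int k) - x (int k - 1))) \<in> o(\<lambda>k. 1 / real k)"
      using increment [OF *(1)] .
    show "(\<lambda>k. norm (x (int k) - T (x (int k)))) \<in> o(\<lambda>k. 1 / real k)"
      using residual [OF *(1)] unfolding r_def .
  qed
qed

end
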